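(* Let $d\ge1$, $1\le p<q\le\infty$, $f\in L_p(\mathbb{T}^d)$, and $\int_{\mathbb{T}^d}f(x)\,dx=0$. If $p=1$ or $q=\infty$ (or both), and $\gamma>d(1/p-1/q)$, then $$\|(-\Delta)^{-\gamma/2}f\|_{q}\lesssim\|f\|_{p}.$$
   Context: $\mathbb{T}^d=\mathbb{R}^d/2\pi\mathbb{Z}^d$, $\|\cdot\|_p$ is the norm of $L_p(\mathbb{T}^d)$. For $f\sim\sum_{k\in\mathbb{Z}^d,\,k\ne0}\widehat f_k e^{i(k,x)}$, $(-\Delta)^{-\gamma/2}f\sim\sum_{k\ne0}|k|^{-\gamma}\widehat f_ke^{i(k,x)}$, $|k|$ being the Euclidean norm; $1/q=0$ for $q=\infty$. $A\lesssim B$ means $A\le CB$ with $C>0$ independent of $f$. *)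

theory Defs
  imports "HOL-Analysis.Analysis" "HOL-Probability.Essential_Supremum"
begin

text \<open>
  Functions on the torus \<open>\<real>\<^sup>d / 2\<pi>\<int>\<^sup>d\<close>, with \<open>d = CARD('n)\<close>, are functions on \<open>\<real>\<^sup>d\<close> that are
  \<open>2\<pi>\<close>-periodic in each coordinate. The measure is Lebesgue measure on a fundamental cube,
  without normalisation.
\<close>

definition torus_periodic :: "(real ^ 'n \<Rightarrow> complex) \<Rightarrow> bool" where
  "torus_periodic f \<longleftrightarrow> (\<forall>x i. f (x + axis i (2 * pi)) = f x)"

definition torus_measure :: "(real ^ 'n) measure" where
  "torus_measure = lebesgue_on (cbox 0 (\<chi> i. 2 * pi))"

text \<open>
  The exponent \<open>p\<close> is meant to lie in \<open>[1, \<infinity>]\<close>. The real-valued \<open>torus_norm\<close> is the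
  \<open>L\<^sub>p\<close> norm only on \<open>torus_Lp p\<close>, since the integral and \<open>enn2real\<close> return junk values
  where the norm is infinite.
\<close>

definition torus_Lp :: "ennreal \<Rightarrow> (real ^ 'n \<Rightarrow> complex) set" where
  "torus_Lp p = {f. torus_periodic f \<and> f \<in> borel_measurable torus_measure \<and>
     (if p = \<infinity> then esssup torus_measure (\<lambda>x. ennreal (norm (f x))) < \<infinity>
      else integrable torus_measure (\<lambda>x. norm (f x) powr enn2real p))}"

definition torus_norm :: "ennreal \<Rightarrow> (real ^ 'n \<Rightarrow> complex) \<Rightarrow> real" where
  "torus_norm p f =
     (if p = \<infinity> then enn2real (esssup torus_measure (\<lambda>x. ennreal (norm (f x))))
      else (LINT x|torus_measure. norm (f x) powr enn2real p) powr (1 / enn2real p))"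

definition real_freq :: "int ^ 'n \<Rightarrow> real ^ 'n" where
  "real_freq k = (\<chi> i. real_of_int (k $ i))"

definition fourier_coeff :: "(real ^ 'n \<Rightarrow> complex) \<Rightarrow> int ^ 'n \<Rightarrow> complex" where
  "fourier_coeff f k =
     (LINT x|torus_measure. f x * cis (- (real_freq k \<bullet> x))) / of_real ((2 * pi) ^ CARD('n))"

text \<open>
  \<open>is_frac_integral \<gamma> f g\<close> says that the formal series
  \<open>(-\<Delta>)\<^bsup>-\<gamma>/2\<^esup> f \<sim> \<Sum>\<^bsub>k \<noteq> 0\<^esub> |k|\<^bsup>-\<gamma>\<^esup> f\<^sub>k e\<^bsup>i(k,x)\<^esup>\<close> is the Fourier series of the integrable function \<open>g\<close>.
  Such a \<open>g\<close> is determined up to a null set by its Fourier coefficients, but need not exist for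
  an arbitrary real \<open>\<gamma>\<close>; hence a relation and not a function.
\<close>

definition is_frac_integral ::
    "real \<Rightarrow> (real ^ 'n \<Rightarrow> complex) \<Rightarrow> (real ^ 'n \<Rightarrow> complex) \<Rightarrow> bool" where
  "is_frac_integral \<gamma> f g \<longleftrightarrow> g \<in> torus_Lp 1 \<and>
     (\<forall>k. fourier_coeff g k =
        (if k = 0 then 0 else of_real (norm (real_freq k) powr (- \<gamma>)) * fourier_coeff f k))"

end

theory Submission
  imports Defs "HOL-Probability.Characteristic_Functions"
begin

text \<open>
  Put \<open>\<alpha> = \<gamma>/2\<close>. By the Gamma integral,
  \<open>|k|\<^bsup>-\<gamma>\<^esup> = \<Gamma>(\<alpha>)\<^bsup>-1\<^esup> \<integral> t\<^bsup>\<alpha>-1\<^esup> exp (- t |k|\<^sup>2) dt\<close> over \<open>(0, \<infinity>)\<close>. The part \<open>t > 1\<close> has Gaussian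
  decay in \<open>k\<close>, so it contributes a bounded, absolutely convergent trigonometric series. The part
  \<open>t \<le> 1\<close> is the average of \<open>f(x + sqrt (2t) z)\<close> over a standard Gaussian vector \<open>z\<close> and over the
  finite measure \<open>\<Gamma>(\<alpha>)\<^bsup>-1\<^esup> t\<^bsup>\<alpha>-1\<^esup> dt\<close>; working on \<open>\<real>\<^sup>d\<close> with a periodic \<open>f\<close> avoids any
  periodised kernel. For fixed \<open>t\<close> the Gaussian average maps \<open>L\<^sub>p\<close> to \<open>L\<^sub>\<infinity>\<close> with norm
  \<open>O(t\<^bsup>-d/(2p)\<^esup>)\<close> and preserves the \<open>L\<^sub>1\<close> norm of a nonnegative function. Integrating the first
  bound in \<open>t\<close> settles \<open>q = \<infinity>\<close>; interpolating between the two and applying Jensen's inequality in \<open>t\<close>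
  settles \<open>p = 1\<close>. In both cases the integral in \<open>t\<close> converges exactly when \<open>\<gamma> > d(1/p - 1/q)\<close>.
\<close>

section \<open>Periodic functions and the fundamental cell\<close>

text \<open>Hoelder's and Jensen's inequalities are replaced by one scalar estimate,
  \<open>a \<le> L + L powr (1 - p) * a powr p\<close> for L > 0. Integrated against a finite
  measure, with L matched to the size of the expected answer, it costs only a constant factor. Since
  L must be positive, the estimates are stated for every A > 0 that dominates the norm of f; the
  norm itself is reached at the very end by letting A decrease to it. The zero frequency is the
  reason for the mean-zero hypothesis: the Gamma integral diverges at k = 0, and averaging
  multiplies that coefficient by a positive mass instead of removing it. The interpolation for p = 1
  is pointwise: of the q powers of the Gaussian average, q - 1 are bounded by its supremum and the
  last one is integrated over the cell. Before Jensen, t^(\<alpha>-1) dt is split as t^\<theta>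
  t^(\<epsilon>-1) dt, with \<theta> such that all powers of t cancel afterwards. Members of L_p are
  Lebesgue measurable on a closed cube, while translations and Fubini are carried out for periodic
  Borel functions on the whole space; a periodic Borel representative connects the two.\<close>

definition lattice_shift :: "int ^ 'n \<Rightarrow> real ^ 'n" where
  "lattice_shift k = (2 * pi) *\<^sub>R real_freq k"

text \<open>Half-open, so that its lattice translates partition the space exactly and no exceptional
  sets arise when integrals are cut up or reassembled.\<close>

definition fund_cell :: "(real ^ 'n) set" where
  "fund_cell = {x. \<forall>i. 0 \<le> x $ i \<and> x $ i < 2 * pi}"

definition cell_index :: "real ^ 'n \<Rightarrow> int ^ 'n" where
  "cell_index x = (\<chi> i. \<lfloor>x $ i / (2 * pi)\<rfloor>)"

definition cell_rep :: "real ^ 'n \<Rightarrow> real ^ 'n" where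
  "cell_rep x = x - lattice_shift (cell_index x)"

text \<open>The exact tiling property, read off coordinatewise from the characterisation of the
  floor. It collapses every lattice sum of indicators of the cell to a single term.\<close>

lemma diff_lattice_shift_in_fund_cell_iff:
  fixes x :: "real ^ 'n"
  shows "x - lattice_shift k \<in> fund_cell \<longleftrightarrow> k = cell_index x"
proof -
  have "(0 \<le> x $ i - 2 * pi * of_int (k $ i) \<and> x $ i - 2 * pi * of_int (k $ i) < 2 * pi)
      \<longleftrightarrow> k $ i = \<lfloor>x $ i / (2 * pi)\<rfloor>" for i
  proof -
    have "k $ i = \<lfloor>x $ i / (2 * pi)\<rfloor> \<longleftrightarrow>
      of_int (k $ i) \<le> x $ i / (2 * pi) \<and> x $ i / (2 * pi) < of_int (k $ i) + 1"
      using floor_eq_iff[of "x $ i / (2 * pi)" "k $ i"] by auto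
    also have "\<dots> \<longleftrightarrow> (0 \<le> x $ i - 2 * pi * of_int (k $ i) \<and> x $ i - 2 * pi * of_int (k $ i) < 2 * pi)"
      by (simp add: field_simps)
    finally show ?thesis by simp
  qed
  then show ?thesis
    by (simp add: fund_cell_def lattice_shift_def real_freq_def cell_index_def vec_eq_iff)
qed

lemma cell_rep_in_fund_cell: "cell_rep x \<in> fund_cell"
  by (simp add: cell_rep_def diff_lattice_shift_in_fund_cell_iff)

lemma lattice_shift_0 [simp]: "lattice_shift 0 = 0"
  by (simp add: lattice_shift_def real_freq_def vec_eq_iff)

lemma cell_rep_id: "x \<in> fund_cell \<Longrightarrow> cell_rep x = x"
  using diff_lattice_shift_in_fund_cell_iff[of x 0] by (auto simp: cell_rep_def)

lemma fund_cell_measurable [measurable]: "(fund_cell :: (real ^ 'n) set) \<in> sets borel"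
proof -
  have "(\<Inter>i\<in>UNIV. {x :: real ^ 'n. 0 \<le> x $ i \<and> x $ i < 2 * pi}) \<in> sets borel"
    by (rule sets.finite_INT) auto
  moreover have "fund_cell = (\<Inter>i\<in>UNIV. {x :: real ^ 'n. 0 \<le> x $ i \<and> x $ i < 2 * pi})"
    by (auto simp: fund_cell_def)
  ultimately show ?thesis by simp
qed

lemma cell_rep_measurable [measurable]:
  "(cell_rep :: real ^ 'n \<Rightarrow> real ^ 'n) \<in> borel \<rightarrow>\<^sub>M borel"
proof -
  have "(\<lambda>x. cell_rep x :: real ^ 'n) \<in> borel_measurable borel"
  proof (subst borel_measurable_euclidean_space, intro ballI)
    fix b :: "real ^ 'n" assume "b \<in> Basis"
    then obtain i where b: "b = axis i 1"
      by (auto simp: Basis_vec_def)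
    have "(\<lambda>x :: real ^ 'n. cell_rep x \<bullet> b) = (\<lambda>x. x $ i - 2 * pi * of_int \<lfloor>x $ i / (2 * pi)\<rfloor>)"
      by (simp add: b inner_axis cell_rep_def lattice_shift_def real_freq_def cell_index_def)
    also have "\<dots> \<in> borel_measurable borel" by measurable
    finally show "(\<lambda>x :: real ^ 'n. cell_rep x \<bullet> b) \<in> borel_measurable borel" .
  qed
  then show ?thesis by simp
qed

lemma nn_integral_lborel_shift:
  fixes h :: "'a::euclidean_space \<Rightarrow> ennreal"
  assumes [measurable]: "h \<in> borel_measurable borel"
  shows "(\<integral>\<^sup>+x. h (x + a) \<partial>lborel) = (\<integral>\<^sup>+x. h x \<partial>lborel)"
  by (subst (2) lborel_distr_plus[symmetric, of a]) (simp add: nn_integral_distr add.commute)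

lemma nn_integral_count_space_singleton:
  "(\<integral>\<^sup>+k. (if k = a then c else 0) \<partial>count_space UNIV) = (c :: ennreal)"
proof -
  have "(\<integral>\<^sup>+k. (if k = a then c else 0) \<partial>count_space UNIV)
      = (\<integral>\<^sup>+k. c * indicator {a} k \<partial>count_space UNIV)"
    by (intro nn_integral_cong) auto
  then show ?thesis by (simp add: nn_integral_cmult)
qed

text \<open>Insert the partition of unity given by the translates of the cell, exchange sum and
  integral, and translate each piece back to the cell.\<close>

lemma nn_integral_lborel_tile:
  fixes h :: "real ^ 'n \<Rightarrow> ennreal"
  assumes [measurable]: "h \<in> borel_measurable borel"
  shows "(\<integral>\<^sup>+x. h x \<partial>lborel) =
    (\<integral>\<^sup>+k. (\<integral>\<^sup>+x. h (x + lattice_shift k) * indicator fund_cell x \<partial>lborel) \<partial>count_space UNIV)"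
proof -
  have "(\<integral>\<^sup>+k. h x * indicator fund_cell (x - lattice_shift k) \<partial>count_space UNIV) = h x"
    for x :: "real ^ 'n"
  proof -
    have "(\<integral>\<^sup>+k. h x * indicator fund_cell (x - lattice_shift k) \<partial>count_space UNIV)
       = (\<integral>\<^sup>+k. (if k = cell_index x then h x else 0) \<partial>count_space UNIV)"
      by (intro nn_integral_cong) (simp add: indicator_def diff_lattice_shift_in_fund_cell_iff)
    then show ?thesis by (simp add: nn_integral_count_space_singleton)
  qed
  then have "(\<integral>\<^sup>+x. h x \<partial>lborel) =
      (\<integral>\<^sup>+x. (\<integral>\<^sup>+k. h x * indicator fund_cell (x - lattice_shift k) \<partial>count_space UNIV) \<partial>lborel)"
    by simp
  also have "\<dots> = (\<integral>\<^sup>+k. (\<integral>\<^sup>+x. h x * indicator fund_cell (x - lattice_shift k) \<partial>lborel) \<partial>count_space UNIV)"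
    by (rule nn_integral_count_space_nn_integral) auto
  also have "\<dots> = (\<integral>\<^sup>+k. (\<integral>\<^sup>+x. h (x + lattice_shift k) * indicator fund_cell x \<partial>lborel)
      \<partial>count_space UNIV)"
    using nn_integral_lborel_shift
      [of "\<lambda>x. h x * indicator fund_cell (x - lattice_shift k)" "lattice_shift k" for k]
    by simp
  finally show ?thesis .
qed

text \<open>Invariance under all lattice vectors at once, with an arbitrary codomain, so that it
  also covers norms and powers with values in \<open>ennreal\<close>.\<close>

definition lattice_periodic :: "(real ^ 'n \<Rightarrow> 'b) \<Rightarrow> bool" where
  "lattice_periodic f \<longleftrightarrow> (\<forall>x k. f (x + lattice_shift k) = f x)"

lemma lattice_periodicD: "lattice_periodic f \<Longrightarrow> f (x + lattice_shift k) = f x"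
  by (simp add: lattice_periodic_def)

lemma lattice_shift_minus: "lattice_shift (- k) = - lattice_shift k"
  by (simp add: lattice_shift_def real_freq_def vec_eq_iff)

lemma lattice_periodicD': "lattice_periodic f \<Longrightarrow> f (x - lattice_shift k) = f x"
  using lattice_periodicD[of f x "- k"] by (simp add: lattice_shift_minus)

lemma lattice_periodic_cell_rep: "lattice_periodic f \<Longrightarrow> f (cell_rep x) = f x"
  by (simp add: cell_rep_def lattice_periodicD')

lemma lattice_periodic_imp_torus_periodic:
  fixes f :: "real ^ 'n \<Rightarrow> complex"
  assumes "lattice_periodic f"
  shows "torus_periodic f"
  unfolding torus_periodic_def
proof (intro allI)
  fix x :: "real ^ 'n" and i
  have "lattice_shift (axis i 1) = (axis i (2 * pi) :: real ^ 'n)"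
    by (auto simp: lattice_shift_def real_freq_def vec_eq_iff axis_def)
  with lattice_periodicD[OF assms, of x "axis i 1"] show "f (x + axis i (2 * pi)) = f x" by simp
qed

text \<open>The Borel counterpart of \<open>torus_measure\<close>: it lives on the Borel sets of the
  whole space, so translations and product measures work without completions.\<close>

definition cell_measure :: "(real ^ 'n) measure" where
  "cell_measure = density lborel (indicator fund_cell)"

lemma sets_cell_measure [measurable_cong, simp]: "sets cell_measure = sets borel"
  by (simp add: cell_measure_def)

lemma space_cell_measure [simp]: "space cell_measure = UNIV"
  by (simp add: cell_measure_def)

lemma nn_integral_cell_measure:
  "h \<in> borel_measurable borel \<Longrightarrow>
    (\<integral>\<^sup>+x. h x \<partial>cell_measure) = (\<integral>\<^sup>+x. h x * indicator fund_cell x \<partial>lborel)"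
  unfolding cell_measure_def by (subst nn_integral_density) (auto simp: mult.commute)

text \<open>A translated cell is again a fundamental domain: it is cut along the tiling, and
  periodicity moves the pieces back into the original cell, which they fill exactly once.\<close>

lemma nn_integral_cell_measure_shift:
  fixes P :: "real ^ 'n \<Rightarrow> ennreal"
  assumes [measurable]: "P \<in> borel_measurable borel" and P: "lattice_periodic P"
  shows "(\<integral>\<^sup>+x. P (x + a) \<partial>cell_measure) = (\<integral>\<^sup>+x. P x \<partial>cell_measure)"
proof -
  \<comment> \<open>Each orbit of the lattice meets the translated cell in exactly one
    point.\<close>
  have one: "(\<integral>\<^sup>+k. indicator fund_cell (x + lattice_shift k - a) \<partial>count_space UNIV) = (1 :: ennreal)"
    for x :: "real ^ 'n"
  proof -
    have "(\<integral>\<^sup>+k. indicator fund_cell (x + lattice_shift k - a) \<partial>count_space UNIV)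
       = (\<integral>\<^sup>+k. (if k = - cell_index (x - a) then 1 else 0 :: ennreal) \<partial>count_space UNIV)"
    proof (intro nn_integral_cong)
      fix k
      have "x + lattice_shift k - a \<in> fund_cell \<longleftrightarrow> k = - cell_index (x - a)"
      proof -
        have "x + lattice_shift k - a = x - a - lattice_shift (- k)"
          by (simp add: lattice_shift_minus)
        then have "x + lattice_shift k - a \<in> fund_cell \<longleftrightarrow> - k = cell_index (x - a)"
          by (simp only: diff_lattice_shift_in_fund_cell_iff)
        then show ?thesis by (metis minus_minus)
      qed
      then show "indicator fund_cell (x + lattice_shift k - a)
          = (if k = - cell_index (x - a) then 1 else 0 :: ennreal)"
        by (simp add: indicator_def)
    qed
    then show ?thesis by (simp add: nn_integral_count_space_singleton)
  qed
  have "(\<integral>\<^sup>+x. P (x + a) \<partial>cell_measure) = (\<integral>\<^sup>+x. P (x + a) * indicator fund_cell x \<partial>lborel)"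
    by (simp add: nn_integral_cell_measure)
  also have "\<dots> = (\<integral>\<^sup>+x. P x * indicator fund_cell (x - a) \<partial>lborel)"
    using nn_integral_lborel_shift[of "\<lambda>x. P x * indicator fund_cell (x - a)" a] by simp
  also have "\<dots> = (\<integral>\<^sup>+k. (\<integral>\<^sup>+x. P (x + lattice_shift k) * indicator fund_cell (x + lattice_shift k - a)
      * indicator fund_cell x \<partial>lborel) \<partial>count_space UNIV)"
    by (subst nn_integral_lborel_tile) auto
  also have "\<dots> = (\<integral>\<^sup>+x. (\<integral>\<^sup>+k. P (x + lattice_shift k) * indicator fund_cell (x + lattice_shift k - a)
      * indicator fund_cell x \<partial>count_space UNIV) \<partial>lborel)"
    by (rule nn_integral_count_space_nn_integral[symmetric]) auto
  also have "\<dots> = (\<integral>\<^sup>+x. (\<integral>\<^sup>+k. (P x * indicator fund_cell x) * indicator fund_cell (x + lattice_shift k - a)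
       \<partial>count_space UNIV) \<partial>lborel)"
    by (simp add: lattice_periodicD[OF P] mult_ac)
  also have "\<dots> = (\<integral>\<^sup>+x. P x * indicator fund_cell x \<partial>lborel)"
    by (subst nn_integral_cmult) (auto simp: one)
  also have "\<dots> = (\<integral>\<^sup>+x. P x \<partial>cell_measure)"
    by (simp add: nn_integral_cell_measure)
  finally show ?thesis .
qed

lemma AE_cell_measure: "AE x in cell_measure. x \<in> fund_cell"
  unfolding cell_measure_def by (subst AE_density) (auto simp: indicator_def)

lemma cell_rep_add_lattice_shift: "cell_rep (x + lattice_shift k) = cell_rep x"
proof -
  have "x + lattice_shift k - lattice_shift (k + cell_index x) = cell_rep x"
    by (simp add: cell_rep_def lattice_shift_def real_freq_def vec_eq_iff algebra_simps)
  moreover from this have "k + cell_index x = cell_index (x + lattice_shift k)"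
    using cell_rep_in_fund_cell[of x] by (simp add: diff_lattice_shift_in_fund_cell_iff[symmetric])
  ultimately show ?thesis
    by (simp add: cell_rep_def)
qed

lemma lattice_periodic_comp_cell_rep: "lattice_periodic (\<lambda>x. h (cell_rep x))"
  by (simp add: lattice_periodic_def cell_rep_add_lattice_shift)

text \<open>Translation modulo the lattice preserves the measure itself, by the nonnegative case
  applied to indicators. As an identity of measures it transfers to Bochner integrals of any
  periodic Borel function.\<close>

lemma distr_cell_measure_shift:
  "distr cell_measure borel (\<lambda>x. cell_rep (x + a)) = (cell_measure :: (real ^ 'n) measure)"
proof (rule measure_eqI)
  fix A :: "(real ^ 'n) set" assume "A \<in> sets (distr cell_measure borel (\<lambda>x. cell_rep (x + a)))"
  then have [measurable]: "A \<in> sets borel" by simp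
  have "emeasure (distr cell_measure borel (\<lambda>x. cell_rep (x + a))) A
      = (\<integral>\<^sup>+x. indicator A (cell_rep (x + a)) \<partial>cell_measure)"
    by (subst nn_integral_indicator[symmetric]) (auto simp: nn_integral_distr simp del: nn_integral_indicator)
  also have "\<dots> = (\<integral>\<^sup>+x. indicator A (cell_rep x) \<partial>cell_measure)"
    by (rule nn_integral_cell_measure_shift)
       (auto intro: lattice_periodic_comp_cell_rep[of "indicator A"])
  also have "\<dots> = (\<integral>\<^sup>+x. indicator A x \<partial>cell_measure)"
    using AE_cell_measure by (intro nn_integral_cong_AE) (auto simp: cell_rep_id)
  also have "\<dots> = emeasure cell_measure A" by simp
  finally show "emeasure (distr cell_measure borel (\<lambda>x. cell_rep (x + a))) A = emeasure cell_measure A" .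
qed simp

lemma integral_cell_measure_shift:
  fixes F :: "real ^ 'n \<Rightarrow> 'b::{banach, second_countable_topology}"
  assumes [measurable]: "F \<in> borel_measurable borel" and F: "lattice_periodic F"
  shows "(LINT x|cell_measure. F (x + a)) = (LINT x|cell_measure. F x)"
  by (subst (2) distr_cell_measure_shift[symmetric, of a])
     (simp add: integral_distr lattice_periodic_cell_rep[OF F])

section \<open>Gaussian measure\<close>

text \<open>Kept as a product over coordinates, so that total mass and characteristic function
  reduce to dimension one.\<close>

definition gauss_density :: "'a::euclidean_space \<Rightarrow> real" where
  "gauss_density x = (\<Prod>b\<in>Basis. std_normal_density (x \<bullet> b))"

definition gauss_measure :: "'a::euclidean_space measure" where
  "gauss_measure = density lborel (\<lambda>x. ennreal (gauss_density x))"

lemma gauss_density_nonneg: "0 \<le> gauss_density x"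
  by (simp add: gauss_density_def prod_nonneg)

lemma gauss_density_measurable [measurable]: "gauss_density \<in> borel_measurable borel"
  unfolding gauss_density_def by measurable

lemma sets_gauss_measure [measurable_cong, simp]: "sets gauss_measure = sets borel"
  by (simp add: gauss_measure_def)

lemma space_gauss_measure [simp]: "space gauss_measure = UNIV"
  by (simp add: gauss_measure_def)

lemma prod_exp_inner_Basis:
  "(\<Prod>b\<in>Basis. exp (- c * (x \<bullet> b)\<^sup>2)) = exp (- c * (norm (x :: 'a::euclidean_space))\<^sup>2 :: real)"
  by (simp add: exp_sum[symmetric] sum_negf sum_distrib_left[symmetric] norm_eq_sqrt_inner
      euclidean_inner[of x x] power2_eq_square sum_nonneg)

lemma gauss_density_le: "gauss_density x \<le> exp (- (norm x)\<^sup>2 / 2)"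
proof -
  have "gauss_density x \<le> (\<Prod>b\<in>Basis. exp (- (1/2) * (x \<bullet> b)\<^sup>2))"
    unfolding gauss_density_def
  proof (rule prod_mono, intro conjI)
    fix b :: 'a
    have "1 / sqrt (2 * pi) \<le> 1"
      using pi_gt3 by simp
    then have "1 / sqrt (2 * pi) * exp (- (x \<bullet> b)\<^sup>2 / 2) \<le> 1 * exp (- (x \<bullet> b)\<^sup>2 / 2)"
      by (intro mult_right_mono) auto
    then show "std_normal_density (x \<bullet> b) \<le> exp (- (1/2) * (x \<bullet> b)\<^sup>2)"
      by (simp add: std_normal_density_def)
  qed simp
  then show ?thesis
    using prod_exp_inner_Basis[of "1/2" x] by simp
qed

lemma nn_integral_exp_neg_norm_square:
  assumes "0 < c"
  shows "(\<integral>\<^sup>+x. ennreal (exp (- c * (norm (x :: 'a::euclidean_space))\<^sup>2)) \<partial>lborel) < \<infinity>"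
proof -
  \<comment> \<open>The standard deviation whose normal density has exponent
    \<open>- c * u\<^sup>2\<close>.\<close>
  define \<sigma> where "\<sigma> = sqrt (1 / (2 * c))"
  have \<sigma>: "0 < \<sigma>" "\<sigma>\<^sup>2 = 1 / (2 * c)"
    using assms by (auto simp: \<sigma>_def)
  have 1: "(\<integral>\<^sup>+u. ennreal (exp (- c * u\<^sup>2)) \<partial>lborel) < \<infinity>"
  proof -
    have "exp (- c * u\<^sup>2) = sqrt (2 * pi * \<sigma>\<^sup>2) * normal_density 0 \<sigma> u" for u
      using \<sigma> assms by (simp add: normal_density_def field_simps)
    moreover have "integrable lborel (\<lambda>u. sqrt (2 * pi * \<sigma>\<^sup>2) * normal_density 0 \<sigma> u)"
      using \<sigma> by (intro integrable_mult_right integrable_normal_density)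
    ultimately have "integrable lborel (\<lambda>u. exp (- c * u\<^sup>2))" by simp
    then show ?thesis by (simp add: integrable_iff_bounded)
  qed
  have "(\<integral>\<^sup>+x. ennreal (exp (- c * (norm (x :: 'a))\<^sup>2)) \<partial>lborel)
      = (\<integral>\<^sup>+x. (\<Prod>b\<in>Basis. ennreal (exp (- c * ((x :: 'a) \<bullet> b)\<^sup>2))) \<partial>lborel)"
    by (simp only: prod_ennreal[OF exp_ge_zero] prod_exp_inner_Basis)
  also have "\<dots> = (\<Prod>b\<in>(Basis :: 'a set). (\<integral>\<^sup>+u. ennreal (exp (- c * u\<^sup>2)) \<partial>lborel))"
    by (subst nn_integral_lborel_prod) auto
  also have "\<dots> < \<infinity>"
    using 1 by (simp add: power_less_top_ennreal)
  finally show ?thesis .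
qed

lemma nn_integral_gauss_density: "(\<integral>\<^sup>+x. ennreal (gauss_density (x :: 'a::euclidean_space)) \<partial>lborel) = 1"
proof -
  have 1: "(\<integral>\<^sup>+u. ennreal (std_normal_density u) \<partial>lborel) = 1"
    using integral_normal_density[of 1 0] integrable_normal_density[of 1 0]
    by (subst nn_integral_eq_integral) auto
  have "(\<integral>\<^sup>+x. ennreal (gauss_density (x :: 'a)) \<partial>lborel)
      = (\<integral>\<^sup>+x. (\<Prod>b\<in>Basis. ennreal (std_normal_density ((x :: 'a) \<bullet> b))) \<partial>lborel)"
    by (simp add: prod_ennreal gauss_density_def)
  also have "\<dots> = (\<Prod>b\<in>(Basis :: 'a set). (\<integral>\<^sup>+u. ennreal (std_normal_density u) \<partial>lborel))"
    by (subst nn_integral_lborel_prod) auto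
  finally show ?thesis by (simp add: 1)
qed

lemma prob_space_gauss_measure: "prob_space gauss_measure"
  by (rule prob_spaceI) (simp add: gauss_measure_def emeasure_density nn_integral_gauss_density)

lemma integral_lborel_prod_Basis:
  fixes f :: "'a::euclidean_space \<Rightarrow> real \<Rightarrow> 'b::{real_normed_field, banach, second_countable_topology}"
  assumes "\<And>b. b \<in> Basis \<Longrightarrow> integrable lborel (f b)"
  shows "(LINT x|lborel. (\<Prod>b\<in>Basis. f b (x \<bullet> b))) = (\<Prod>b\<in>Basis. LINT u|lborel. f b u)"
proof -
  interpret product_sigma_finite "\<lambda>_::'a. lborel :: real measure" ..
  have [measurable]: "f b \<in> borel_measurable borel" if "b \<in> Basis" for b
    using borel_measurable_integrable[OF assms[OF that]] by simp
  have "(LINT x|lborel. (\<Prod>b\<in>Basis. f b (x \<bullet> b)))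
      = (LINT y|(\<Pi>\<^sub>M b\<in>(Basis :: 'a set). lborel). (\<Prod>b\<in>Basis. f b (y b)))"
    by (subst lborel_eq, subst integral_distr) auto
  also have "\<dots> = (\<Prod>b\<in>Basis. LINT u|lborel. f b u)"
    by (rule product_integral_prod) (auto intro: assms)
  finally show ?thesis .
qed

lemma borel_measurable_cis [measurable]: "cis \<in> borel_measurable borel"
  by (intro borel_measurable_continuous_onI continuous_intros)

lemma integral_std_normal_density_cis:
  "integrable lborel (\<lambda>u. of_real (std_normal_density u) * cis (a * u))"
  "(LINT u|lborel. of_real (std_normal_density u) * cis (a * u)) = of_real (exp (- a\<^sup>2 / 2))"
proof -
  show "integrable lborel (\<lambda>u. of_real (std_normal_density u) * cis (a * u))"
    by (rule Bochner_Integration.integrable_bound[OF integrable_normal_density[of 1 0]])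
       (auto simp: norm_mult)
  have "(LINT u|lborel. of_real (std_normal_density u) * cis (a * u)) = char std_normal_distribution a"
    unfolding char_def by (subst integral_density) (auto simp: scaleR_conv_of_real cis_conv_exp)
  then show "(LINT u|lborel. of_real (std_normal_density u) * cis (a * u)) = of_real (exp (- a\<^sup>2 / 2))"
    by (simp add: char_std_normal_distribution)
qed

lemma cis_sum: "finite S \<Longrightarrow> cis (\<Sum>b\<in>S. f b) = (\<Prod>b\<in>S. cis (f b))"
  by (induction S rule: finite_induct) (auto simp: cis_mult[symmetric])

text \<open>The characteristic function factors over the coordinates. With k scaled by
  \<open>sqrt (2 * t)\<close> the right-hand side becomes the heat multiplier exp(- t
  |k|^2).\<close>

lemma integral_gauss_measure_cis:
  fixes k :: "'a::euclidean_space"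
  shows "(LINT z|gauss_measure. cis (k \<bullet> z)) = of_real (exp (- (norm k)\<^sup>2 / 2))"
proof -
  have "(LINT z|gauss_measure. cis (k \<bullet> z)) = (LINT z|lborel. of_real (gauss_density z) * cis (k \<bullet> z))"
    unfolding gauss_measure_def
    by (subst integral_density) (auto simp: gauss_density_nonneg scaleR_conv_of_real)
  also have "\<dots> = (LINT z|lborel. (\<Prod>b\<in>Basis. of_real (std_normal_density (z \<bullet> b)) * cis ((k \<bullet> b) * (z \<bullet> b))))"
  proof (rule Bochner_Integration.integral_cong)
    fix z :: 'a
    have "cis (k \<bullet> z) = (\<Prod>b\<in>Basis. cis ((k \<bullet> b) * (z \<bullet> b)))"
      by (subst euclidean_inner) (rule cis_sum, simp)
    then show "of_real (gauss_density z) * cis (k \<bullet> z) =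
        (\<Prod>b\<in>Basis. of_real (std_normal_density (z \<bullet> b)) * cis ((k \<bullet> b) * (z \<bullet> b)))"
      by (simp only: gauss_density_def of_real_prod prod.distrib)
  qed simp
  also have "\<dots> = (\<Prod>b\<in>Basis. of_real (exp (- (k \<bullet> b)\<^sup>2 / 2)))"
    using integral_lborel_prod_Basis[of "\<lambda>b u. of_real (std_normal_density u) * cis ((k \<bullet> b) * u)"]
    by (simp only: integral_std_normal_density_cis)
  also have "\<dots> = of_real (exp (- (norm k)\<^sup>2 / 2))"
    using prod_exp_inner_Basis[of "1/2" k] by (simp flip: of_real_prod)
  finally show ?thesis .
qed

lemma nn_integral_lborel_scale:
  fixes h :: "'a::euclidean_space \<Rightarrow> ennreal"
  assumes [measurable]: "h \<in> borel_measurable borel" and s: "0 < s"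
  shows "(\<integral>\<^sup>+x. h (s *\<^sub>R x) \<partial>lborel) = ennreal (s powr - real DIM('a)) * (\<integral>\<^sup>+x. h x \<partial>lborel)"
proof -
  have "(\<integral>\<^sup>+x. h x \<partial>lborel) = ennreal (s ^ DIM('a)) * (\<integral>\<^sup>+x. h (s *\<^sub>R x) \<partial>lborel)"
    using s by (subst lborel_affine[of s 0])
      (simp_all add: nn_integral_density nn_integral_distr nn_integral_cmult)
  moreover have "ennreal (s powr - real DIM('a)) * ennreal (s ^ DIM('a)) = 1"
    using s by (simp add: ennreal_mult[symmetric] powr_realpow[symmetric] powr_add[symmetric])
  ultimately show ?thesis
    by (simp add: mult.assoc[symmetric])
qed

section \<open>Volume of the cell and uniform bounds for lattice sums of Gaussians\<close>

lemma
  shows box_subset_fund_cell: "box 0 (\<chi> i. 2 * pi) \<subseteq> (fund_cell :: (real ^ 'n) set)"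
    and fund_cell_subset_cbox: "fund_cell \<subseteq> (cbox 0 (\<chi> i. 2 * pi) :: (real ^ 'n) set)"
  by (auto simp: fund_cell_def mem_box Basis_vec_def inner_axis less_imp_le)

lemma prod_Basis_cart: "(\<Prod>b\<in>Basis. f b) = (\<Prod>i\<in>(UNIV :: 'n::finite set). f (axis i (1 :: real)))"
proof -
  have "Basis = (\<lambda>i. axis i 1 :: real ^ 'n) ` UNIV"
    by (auto simp: Basis_vec_def)
  moreover have "inj (\<lambda>i. axis i 1 :: real ^ 'n)"
    by (auto simp: inj_on_def axis_eq_axis)
  ultimately show ?thesis by (metis (no_types, lifting) comp_apply prod.cong prod.reindex)
qed

text \<open>The cell lies between the open and the closed box, whose volumes agree.\<close>

lemma emeasure_fund_cell: "emeasure lborel (fund_cell :: (real ^ 'n) set) = ennreal ((2 * pi) ^ CARD('n))"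
proof (rule antisym)
  have 1: "emeasure lborel (cbox 0 (\<chi> i. 2 * pi) :: (real ^ 'n) set) = ennreal ((2 * pi) ^ CARD('n))"
    by (subst emeasure_lborel_cbox_eq) (auto simp: prod_Basis_cart inner_axis simp flip: Basis_vec_def, auto simp: Basis_vec_def inner_axis)
  have 2: "emeasure lborel (box 0 (\<chi> i. 2 * pi) :: (real ^ 'n) set) = ennreal ((2 * pi) ^ CARD('n))"
    by (subst emeasure_lborel_box_eq) (auto simp: prod_Basis_cart inner_axis simp flip: Basis_vec_def, auto simp: Basis_vec_def inner_axis)
  show "emeasure lborel (fund_cell :: (real ^ 'n) set) \<le> ennreal ((2 * pi) ^ CARD('n))"
    unfolding 1[symmetric] by (rule emeasure_mono[OF fund_cell_subset_cbox]) simp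
  show "ennreal ((2 * pi) ^ CARD('n)) \<le> emeasure lborel (fund_cell :: (real ^ 'n) set)"
    unfolding 2[symmetric] by (rule emeasure_mono[OF box_subset_fund_cell]) simp
qed

lemma norm_fund_cell_diff_le:
  fixes x y :: "real ^ 'n"
  assumes "x \<in> fund_cell" "y \<in> fund_cell"
  shows "norm (x - y) \<le> 2 * pi * real CARD('n)"
proof -
  have "norm (x - y) \<le> (\<Sum>i\<in>UNIV. \<bar>(x - y) $ i\<bar>)" by (rule norm_le_l1_cart)
  also have "\<dots> \<le> (\<Sum>i\<in>(UNIV :: 'n set). 2 * pi)"
  proof (rule sum_mono)
    fix i
    have "0 \<le> x $ i" "x $ i < 2 * pi" "0 \<le> y $ i" "y $ i < 2 * pi"
      using assms by (auto simp: fund_cell_def)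
    then show "\<bar>(x - y) $ i\<bar> \<le> 2 * pi" by simp
  qed
  finally show ?thesis by (simp add: mult.commute)
qed

text \<open>Each value is compared with its average over the cell; the sum of the averages is a Gaussian integral.\<close>

lemma lattice_gauss_sum_bound:
  assumes c: "0 < c"
  obtains C where "0 < C"
    "\<And>Y :: int ^ 'n \<Rightarrow> real ^ 'n. (\<And>k. Y k \<in> fund_cell) \<Longrightarrow>
      (\<integral>\<^sup>+k. ennreal (exp (- c * (norm (Y k + lattice_shift k))\<^sup>2)) \<partial>count_space UNIV) \<le> ennreal C"
proof -
  define D where "D = 2 * pi * real CARD('n)"
  define m where "m = (2 * pi) ^ CARD('n)"
  have m: "0 < m" by (simp add: m_def)
  let ?h = "\<lambda>y :: real ^ 'n. ennreal (exp (- (c / 2) * (norm y)\<^sup>2))"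
  let ?I = "\<integral>\<^sup>+y. ?h y \<partial>lborel"
  have I: "?I < \<infinity>"
    using nn_integral_exp_neg_norm_square[of "c / 2"] c by simp
  have bound: "(\<integral>\<^sup>+k. ennreal (exp (- c * (norm (Y k + lattice_shift k))\<^sup>2)) \<partial>count_space UNIV)
      \<le> ennreal (exp (c * D\<^sup>2) / m) * ?I"
    if Y: "\<And>k. Y k \<in> fund_cell" for Y :: "int ^ 'n \<Rightarrow> real ^ 'n"
  proof -
    \<comment> \<open>Moving a point within the cell changes it by at most D, and (a + D)^2 \<le> 2
      a^2 + 2 D^2. Halving the rate of the Gaussian therefore absorbs the move at the price of the
      factor exp(c D^2).\<close>
    have pt: "exp (- c * (norm (Y k + lattice_shift k))\<^sup>2)
        \<le> exp (c * D\<^sup>2) * exp (- (c / 2) * (norm (y + lattice_shift k))\<^sup>2)"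
      if "y \<in> fund_cell" for y k
    proof -
      have "norm (y + lattice_shift k) \<le> norm (Y k + lattice_shift k) + norm (y - Y k)"
        using norm_triangle_ineq[of "Y k + lattice_shift k" "y - Y k"] by (simp add: add.commute)
      also have "\<dots> \<le> norm (Y k + lattice_shift k) + D"
        using norm_fund_cell_diff_le[OF that Y[of k]] by (simp add: D_def)
      finally have "(norm (y + lattice_shift k))\<^sup>2 \<le> (norm (Y k + lattice_shift k) + D)\<^sup>2"
        by (intro power_mono) auto
      also have "\<dots> \<le> 2 * (norm (Y k + lattice_shift k))\<^sup>2 + 2 * D\<^sup>2"
        using sum_squares_ge_zero[of "norm (Y k + lattice_shift k) - D" 0]
        by (simp add: power2_eq_square algebra_simps)
      finally have "(c / 2) * (norm (y + lattice_shift k))\<^sup>2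
          \<le> (c / 2) * (2 * (norm (Y k + lattice_shift k))\<^sup>2 + 2 * D\<^sup>2)"
        using c by (intro mult_left_mono) auto
      then show ?thesis
        by (simp add: exp_add[symmetric] algebra_simps)
    qed
    have "ennreal (exp (- c * (norm (Y k + lattice_shift k))\<^sup>2))
      \<le> ennreal (exp (c * D\<^sup>2) / m) * (\<integral>\<^sup>+y. ?h (y + lattice_shift k) * indicator fund_cell y \<partial>lborel)" for k
    proof -
      let ?e = "ennreal (exp (- c * (norm (Y k + lattice_shift k))\<^sup>2))"
      have "?e * ennreal m = (\<integral>\<^sup>+y. ?e * indicator fund_cell (y :: real ^ 'n) \<partial>lborel)"
        by (simp add: nn_integral_cmult emeasure_fund_cell m_def)
      also have "\<dots> \<le> (\<integral>\<^sup>+y. ennreal (exp (c * D\<^sup>2)) * (?h (y + lattice_shift k) * indicator fund_cell y) \<partial>lborel)"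
        using pt by (intro nn_integral_mono) (auto simp: indicator_def ennreal_mult[symmetric])
      also have "\<dots> = ennreal (exp (c * D\<^sup>2)) * (\<integral>\<^sup>+y. ?h (y + lattice_shift k) * indicator fund_cell y \<partial>lborel)"
        by (subst nn_integral_cmult) auto
      finally have "?e * ennreal m * ennreal (1 / m) \<le>
        ennreal (exp (c * D\<^sup>2)) * (\<integral>\<^sup>+y. ?h (y + lattice_shift k) * indicator fund_cell y \<partial>lborel) * ennreal (1 / m)"
        by (rule mult_right_mono) simp
      moreover have "?e * ennreal m * ennreal (1 / m) = ?e"
        using m by (simp add: mult.assoc ennreal_mult[symmetric])
      moreover have "ennreal (exp (c * D\<^sup>2) / m) = ennreal (exp (c * D\<^sup>2)) * ennreal (1 / m)"
        using m by (simp add: ennreal_mult[symmetric])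
      ultimately show ?thesis
        by (simp add: mult_ac)
    qed
    then have "(\<integral>\<^sup>+k. ennreal (exp (- c * (norm (Y k + lattice_shift k))\<^sup>2)) \<partial>count_space UNIV) \<le>
      (\<integral>\<^sup>+k. ennreal (exp (c * D\<^sup>2) / m) *
        (\<integral>\<^sup>+y. ?h (y + lattice_shift k) * indicator fund_cell y \<partial>lborel) \<partial>count_space UNIV)"
      by (intro nn_integral_mono)
    also have "\<dots> = ennreal (exp (c * D\<^sup>2) / m) * ?I"
      by (subst nn_integral_cmult, simp, subst nn_integral_lborel_tile[of ?h]) simp_all
    finally show ?thesis .
  qed
  have "ennreal (exp (c * D\<^sup>2) / m) * ?I < \<infinity>"
    using I by (simp add: ennreal_mult_less_top)
  then obtain r where r: "0 \<le> r" "ennreal (exp (c * D\<^sup>2) / m) * ?I = ennreal r"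
    by (cases "ennreal (exp (c * D\<^sup>2) / m) * ?I") auto
  show ?thesis
  \<comment> \<open>\<open>r\<close> is only known to be nonnegative; adding 1 makes the constant
    positive.\<close>
  proof (rule that[of "r + 1"])
    show "(\<integral>\<^sup>+k. ennreal (exp (- c * (norm (Y k + lattice_shift k))\<^sup>2)) \<partial>count_space UNIV) \<le> ennreal (r + 1)"
      if "\<And>k. Y k \<in> fund_cell" for Y :: "int ^ 'n \<Rightarrow> real ^ 'n"
    proof -
      have "(\<integral>\<^sup>+k. ennreal (exp (- c * (norm (Y k + lattice_shift k))\<^sup>2)) \<partial>count_space UNIV) \<le> ennreal r"
        using bound[OF that] r(2) by simp
      also have "\<dots> \<le> ennreal (r + 1)" by (rule ennreal_leI) simp
      finally show ?thesis .
    qed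
  qed (use r in simp)
qed

text \<open>The smoothing estimate from L_1 to the supremum. After scaling, the kernel is s^(-d)
  times a Gaussian with exponent - |y|^2 / (2 s^2). For s^2 \<le> 2 this lies below exp(- |y|^2 / 4)
  independently of s, and folding along the lattice gives a sum that is bounded uniformly in
  y.\<close>

lemma nn_integral_gauss_measure_periodic_le:
  obtains C where "0 < C"
    "\<And>(P :: real ^ 'n \<Rightarrow> ennreal) s x. P \<in> borel_measurable borel \<Longrightarrow> lattice_periodic P \<Longrightarrow>
      0 < s \<Longrightarrow> s\<^sup>2 \<le> 2 \<Longrightarrow>
      (\<integral>\<^sup>+z. P (x + s *\<^sub>R z) \<partial>gauss_measure)
        \<le> ennreal (C * s powr - real CARD('n)) * (\<integral>\<^sup>+y. P y \<partial>cell_measure)"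
proof -
  obtain C where C: "0 < C"
    "\<And>Y :: int ^ 'n \<Rightarrow> real ^ 'n. (\<And>k. Y k \<in> fund_cell) \<Longrightarrow>
      (\<integral>\<^sup>+k. ennreal (exp (- (1 / 4) * (norm (Y k + lattice_shift k))\<^sup>2)) \<partial>count_space UNIV) \<le> ennreal C"
    using lattice_gauss_sum_bound[of "1 / 4"] by auto
  have "(\<integral>\<^sup>+z. P (x + s *\<^sub>R z) \<partial>gauss_measure)
        \<le> ennreal (C * s powr - real CARD('n)) * (\<integral>\<^sup>+y. P y \<partial>cell_measure)"
    if [measurable]: "P \<in> borel_measurable borel" and P: "lattice_periodic P" and s: "0 < s" "s\<^sup>2 \<le> 2"
    for P :: "real ^ 'n \<Rightarrow> ennreal" and s x
  proof -
    let ?G = "\<lambda>y :: real ^ 'n. ennreal (exp (- (1 / 4) * (norm y)\<^sup>2))"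
    have "(\<integral>\<^sup>+z. P (x + s *\<^sub>R z) \<partial>gauss_measure)
        = (\<integral>\<^sup>+z. ennreal (gauss_density z) * P (x + s *\<^sub>R z) \<partial>lborel)"
      unfolding gauss_measure_def by (subst nn_integral_density) auto
    also have "\<dots> = (\<integral>\<^sup>+z. (\<lambda>y. ennreal (gauss_density ((1 / s) *\<^sub>R y)) * P (x + y)) (s *\<^sub>R z) \<partial>lborel)"
      using s by simp
    also have "\<dots> = ennreal (s powr - real CARD('n)) *
        (\<integral>\<^sup>+y. ennreal (gauss_density ((1 / s) *\<^sub>R y)) * P (x + y) \<partial>lborel)"
      using s by (subst nn_integral_lborel_scale) auto
    finally have eq: "(\<integral>\<^sup>+z. P (x + s *\<^sub>R z) \<partial>gauss_measure) = ennreal (s powr - real CARD('n)) *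
        (\<integral>\<^sup>+y. ennreal (gauss_density ((1 / s) *\<^sub>R y)) * P (x + y) \<partial>lborel)" .
    have "(\<integral>\<^sup>+y. ennreal (gauss_density ((1 / s) *\<^sub>R y)) * P (x + y) \<partial>lborel)
        \<le> (\<integral>\<^sup>+y. ?G y * P (x + y) \<partial>lborel)"
    proof (intro nn_integral_mono mult_right_mono ennreal_leI)
      fix y :: "real ^ 'n"
      have "(norm y)\<^sup>2 * s\<^sup>2 \<le> (norm y)\<^sup>2 * 2"
        using s by (intro mult_left_mono) auto
      then have "exp (- (norm ((1 / s) *\<^sub>R y))\<^sup>2 / 2) \<le> exp (- (1 / 4) * (norm y)\<^sup>2)"
        using s by (simp add: power_divide field_simps)
      then show "gauss_density ((1 / s) *\<^sub>R y) \<le> exp (- (1 / 4) * (norm y)\<^sup>2)"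
        using gauss_density_le[of "(1 / s) *\<^sub>R y"] by linarith
    qed auto
    also have "(\<integral>\<^sup>+y. ?G y * P (x + y) \<partial>lborel) =
        (\<integral>\<^sup>+k. (\<integral>\<^sup>+y. ?G (y + lattice_shift k) * P (x + (y + lattice_shift k)) * indicator fund_cell y \<partial>lborel)
          \<partial>count_space UNIV)"
      by (subst nn_integral_lborel_tile) auto
    also have "\<dots> = (\<integral>\<^sup>+y. (\<integral>\<^sup>+k. ?G (y + lattice_shift k) * P (x + (y + lattice_shift k)) * indicator fund_cell y
          \<partial>count_space UNIV) \<partial>lborel)"
      by (rule nn_integral_count_space_nn_integral[symmetric]) auto
    also have "\<dots> = (\<integral>\<^sup>+y. (\<integral>\<^sup>+k. ?G (y + lattice_shift k) \<partial>count_space UNIV) * (P (x + y) * indicator fund_cell y) \<partial>lborel)"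
      using lattice_periodicD[OF P]
      by (subst nn_integral_multc[symmetric]) (auto simp: add.assoc[symmetric] mult_ac)
    also have "\<dots> \<le> (\<integral>\<^sup>+y. ennreal C * (P (x + y) * indicator fund_cell y) \<partial>lborel)"
    proof (intro nn_integral_mono)
      fix y :: "real ^ 'n"
      show "(\<integral>\<^sup>+k. ?G (y + lattice_shift k) \<partial>count_space UNIV) * (P (x + y) * indicator fund_cell y)
          \<le> ennreal C * (P (x + y) * indicator fund_cell y)"
        using C(2)[of "\<lambda>_. y"] by (cases "y \<in> fund_cell") (auto intro: mult_right_mono)
    qed
    also have "\<dots> = ennreal C * (\<integral>\<^sup>+y. P (y + x) \<partial>cell_measure)"
      by (subst nn_integral_cmult) (auto simp: nn_integral_cell_measure add.commute)
    also have "\<dots> = ennreal C * (\<integral>\<^sup>+y. P y \<partial>cell_measure)"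
      by (simp add: nn_integral_cell_measure_shift P)
    finally have "(\<integral>\<^sup>+z. P (x + s *\<^sub>R z) \<partial>gauss_measure) \<le>
        ennreal (s powr - real CARD('n)) * (ennreal C * (\<integral>\<^sup>+y. P y \<partial>cell_measure))"
      unfolding eq by (rule mult_left_mono) simp
    then show ?thesis
      using C(1) by (simp add: ennreal_mult mult_ac)
  qed
  with C(1) that show ?thesis by blast
qed

section \<open>Fourier coefficients of trigonometric series and of averages\<close>

interpretation cell_measure: finite_measure cell_measure
  by standard (simp add: cell_measure_def emeasure_density emeasure_fund_cell)

lemma measure_cell_measure: "measure cell_measure (UNIV :: (real ^ 'n) set) = (2 * pi) ^ CARD('n)"
  by (simp add: cell_measure_def measure_def emeasure_density emeasure_fund_cell)

lemma cis_real_freq_periodic: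
  fixes k :: "int ^ 'n"
  shows "cis (real_freq k \<bullet> (x + lattice_shift m)) = cis (real_freq k \<bullet> x)"
proof -
  have "real_freq k \<bullet> lattice_shift m = 2 * pi * of_int (\<Sum>i\<in>UNIV. k $ i * m $ i)"
    by (simp add: lattice_shift_def real_freq_def inner_vec_def sum_distrib_left mult_ac)
  then have "cis (real_freq k \<bullet> lattice_shift m) = 1"
    by (metis cis_multiple_2pi Ints_of_int)
  then show ?thesis
    by (simp add: inner_add_right cis_mult[symmetric])
qed

text \<open>For k \<noteq> 0, translating by a vector \<open>a\<close> with k . a = \<pi> turns the
  character into its negative, so the integral equals its own negative.\<close>

lemma integral_cell_measure_cis:
  fixes k :: "int ^ 'n"
  shows "(LINT x|cell_measure. cis (real_freq k \<bullet> x)) = (if k = 0 then of_real ((2 * pi) ^ CARD('n)) else 0)"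
proof (cases "k = 0")
  case True
  then show ?thesis
    by (simp add: real_freq_def zero_vec_def[symmetric] measure_cell_measure scaleR_conv_of_real)
next
  case False
  then obtain i where i: "k $ i \<noteq> 0" by (auto simp: vec_eq_iff)
  define a :: "real ^ 'n" where "a = axis i (pi / of_int (k $ i))"
  have a: "real_freq k \<bullet> a = pi"
    using i by (simp add: a_def inner_axis real_freq_def)
  have "(LINT x|cell_measure. cis (real_freq k \<bullet> x)) = (LINT x|cell_measure. cis (real_freq k \<bullet> (x + a)))"
    by (rule integral_cell_measure_shift[symmetric])
       (auto simp: lattice_periodic_def cis_real_freq_periodic)
  also have "\<dots> = (LINT x|cell_measure. - cis (real_freq k \<bullet> x))"
    by (simp add: inner_add_right a cis_mult[symmetric])
  finally show ?thesis using False by (simp add: equal_neg_zero)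
qed

lemma real_freq_measurable_count_space [measurable]: "real_freq \<in> borel_measurable (count_space UNIV)"
  by simp

text \<open>The series is an integral against counting measure, so that its Fourier coefficients
  come from Fubini and orthogonality of characters.\<close>

lemma
  fixes c :: "int ^ 'n \<Rightarrow> complex"
  assumes c: "integrable (count_space UNIV) c"
  defines "g \<equiv> (\<lambda>x. LINT k|count_space UNIV. c k * cis (real_freq k \<bullet> x))"
  shows trig_series_measurable: "g \<in> borel_measurable borel"
    and trig_series_periodic: "lattice_periodic g"
    and norm_trig_series_le: "norm (g x) \<le> (LINT k|count_space UNIV. norm (c k))"
    and trig_series_coeff: "(LINT x|cell_measure. g x * cis (- (real_freq m \<bullet> x))) = of_real ((2 * pi) ^ CARD('n)) * c m"
proof -
  interpret C: sigma_finite_measure "count_space (UNIV :: (int ^ 'n) set)"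
    by (rule sigma_finite_measure_count_space)
  interpret P: pair_sigma_finite cell_measure "count_space (UNIV :: (int ^ 'n) set)" ..
  have [measurable]: "c \<in> borel_measurable (count_space UNIV)" by simp
  show "g \<in> borel_measurable borel"
    unfolding g_def by measurable
  show "lattice_periodic g"
    by (simp add: g_def lattice_periodic_def cis_real_freq_periodic)
  show "norm (g x) \<le> (LINT k|count_space UNIV. norm (c k))"
    unfolding g_def using integral_norm_bound[of "count_space UNIV" "\<lambda>k. c k * cis (real_freq k \<bullet> x)"]
    by (simp add: norm_mult)
  \<comment> \<open>The modulus is \<open>norm (c k)\<close> for every x and the cell has finite
    measure, so summability of \<open>c\<close> suffices.\<close>
  have "integrable (cell_measure \<Otimes>\<^sub>M count_space (UNIV :: (int ^ 'n) set)) (\<lambda>(x, k). c k * cis (real_freq (k - m) \<bullet> x))"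
  proof (rule P.Fubini_integrable)
    show "integrable cell_measure (\<lambda>x. LINT k|count_space UNIV. norm (case (x, k) of (x, k) \<Rightarrow> c k * cis (real_freq (k - m) \<bullet> x)))"
      by (simp add: norm_mult)
    show "AE x in cell_measure. integrable (count_space UNIV) (\<lambda>k. case (x, k) of (x, k) \<Rightarrow> c k * cis (real_freq (k - m) \<bullet> x))"
      by (intro AE_I2) (auto intro: Bochner_Integration.integrable_bound[OF c] simp: norm_mult)
  qed measurable
  then have "(LINT x|cell_measure. (LINT k|count_space UNIV. c k * cis (real_freq (k - m) \<bullet> x)))
      = (LINT k|count_space UNIV. (LINT x|cell_measure. c k * cis (real_freq (k - m) \<bullet> x)))"
    by (rule P.Fubini_integral[symmetric])
  also have "\<dots> = (LINT k|count_space UNIV. indicator {m} k *\<^sub>R (of_real ((2 * pi) ^ CARD('n)) * c m))"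
    by (intro Bochner_Integration.integral_cong) (auto simp: integral_cell_measure_cis indicator_def)
  also have "\<dots> = of_real ((2 * pi) ^ CARD('n)) * c m"
    by simp
  finally have *: "(LINT x|cell_measure. (LINT k|count_space UNIV. c k * cis (real_freq (k - m) \<bullet> x)))
      = of_real ((2 * pi) ^ CARD('n)) * c m" .
  have "(LINT k|count_space UNIV. c k * cis (real_freq (k - m) \<bullet> x)) = g x * cis (- (real_freq m \<bullet> x))" for x
  proof -
    have "real_freq (k - m) \<bullet> x = real_freq k \<bullet> x + - (real_freq m \<bullet> x)" for k
      by (simp add: real_freq_def inner_vec_def sum_subtractf algebra_simps)
    then show ?thesis
      unfolding g_def by (simp only: cis_mult[symmetric] mult.assoc[symmetric]) simp
  qed
  with * show "(LINT x|cell_measure. g x * cis (- (real_freq m \<bullet> x))) = of_real ((2 * pi) ^ CARD('n)) * c m"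
    by simp
qed

text \<open>Averages of f over random displacements \<open>s w\<close>. A displacement multiplies
  the k-th Fourier coefficient by \<open>cis (real_freq k \<bullet> s w)\<close>, so the average has
  the characteristic function of the displacement as its multiplier.\<close>

locale periodic_averaging =
  finite_measure M for M :: "'w measure" +
  fixes s :: "'w \<Rightarrow> real ^ 'n" and f :: "real ^ 'n \<Rightarrow> complex"
  assumes s_measurable [measurable]: "s \<in> borel_measurable M"
    and f_measurable [measurable]: "f \<in> borel_measurable borel"
    and f_periodic: "lattice_periodic f"
    and f_integrable: "integrable cell_measure f"
begin

definition average :: "real ^ 'n \<Rightarrow> complex" where
  "average x = (LINT w|M. f (x + s w))"

sublocale P: pair_sigma_finite cell_measure M ..

lemma average_measurable: "average \<in> borel_measurable borel"
  unfolding average_def by measurable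

lemma average_periodic: "lattice_periodic average"
proof -
  have "f (x + lattice_shift k + s w) = f (x + s w)" for x k w
    using lattice_periodicD[OF f_periodic, of "x + s w" k] by (simp only: ac_simps)
  then show ?thesis
    by (simp add: average_def lattice_periodic_def)
qed

text \<open>By translation invariance each displacement contributes the same L_1 norm of f, and the
  displacement measure is finite.\<close>

lemma integrable_pair: "integrable (cell_measure \<Otimes>\<^sub>M M) (\<lambda>(x, w). f (x + s w))"
proof (rule integrableI_bounded)
  have "(\<integral>\<^sup>+p. norm (case p of (x, w) \<Rightarrow> f (x + s w)) \<partial>(cell_measure \<Otimes>\<^sub>M M))
      = (\<integral>\<^sup>+w. (\<integral>\<^sup>+x. norm (f (x + s w)) \<partial>cell_measure) \<partial>M)"
    by (subst P.nn_integral_snd[symmetric]) auto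
  also have "\<dots> = (\<integral>\<^sup>+w. (\<integral>\<^sup>+x. norm (f x) \<partial>cell_measure) \<partial>M)"
    using f_periodic
    by (intro nn_integral_cong nn_integral_cell_measure_shift) (auto simp: lattice_periodic_def)
  also have "\<dots> < \<infinity>"
    using f_integrable
    by (simp add: integrable_iff_bounded ennreal_mult_less_top emeasure_eq_measure)
  finally show "(\<integral>\<^sup>+p. norm (case p of (x, w) \<Rightarrow> f (x + s w)) \<partial>(cell_measure \<Otimes>\<^sub>M M)) < \<infinity>" .
qed measurable

lemma average_integrable: "integrable cell_measure average"
  unfolding average_def using P.integrable_fst[OF integrable_pair] .

lemma average_coeff:
  "(LINT x|cell_measure. average x * cis (- (real_freq k \<bullet> x)))
    = (LINT w|M. cis (real_freq k \<bullet> s w)) * (LINT x|cell_measure. f x * cis (- (real_freq k \<bullet> x)))"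
proof -
  let ?e = "\<lambda>x. cis (- (real_freq k \<bullet> x))"
  have e: "lattice_periodic (\<lambda>x. f x * ?e x)"
    using cis_real_freq_periodic[of k]
    by (simp add: lattice_periodic_def lattice_periodicD[OF f_periodic] cis_cnj[symmetric] del: cis_cnj)
  have "integrable (cell_measure \<Otimes>\<^sub>M M) (\<lambda>(x, w). f (x + s w) * ?e x)"
    by (rule Bochner_Integration.integrable_bound[OF integrable_pair]) (auto simp: norm_mult)
  then have "(LINT x|cell_measure. (LINT w|M. f (x + s w) * ?e x)) = (LINT w|M. (LINT x|cell_measure. f (x + s w) * ?e x))"
    by (rule P.Fubini_integral[symmetric])
  also have "\<dots> = (LINT w|M. cis (real_freq k \<bullet> s w) * (LINT x|cell_measure. f x * ?e x))"
  proof (rule Bochner_Integration.integral_cong)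
    fix w
    have "(LINT x|cell_measure. f (x + s w) * ?e x)
        = (LINT x|cell_measure. cis (real_freq k \<bullet> s w) * (f (x + s w) * ?e (x + s w)))"
    proof (rule Bochner_Integration.integral_cong)
      fix x
      have "cis (real_freq k \<bullet> s w) * ?e (x + s w) = ?e x"
        by (simp add: cis_mult inner_add_right)
      then show "f (x + s w) * ?e x = cis (real_freq k \<bullet> s w) * (f (x + s w) * ?e (x + s w))"
        by (metis mult.left_commute)
    qed simp
    also have "\<dots> = cis (real_freq k \<bullet> s w) * (LINT x|cell_measure. f (x + s w) * ?e (x + s w))"
      by simp
    also have "(LINT x|cell_measure. f (x + s w) * ?e (x + s w)) = (LINT x|cell_measure. f x * ?e x)"
      by (rule integral_cell_measure_shift[OF _ e]) measurable
    finally show "(LINT x|cell_measure. f (x + s w) * ?e x) = cis (real_freq k \<bullet> s w) * (LINT x|cell_measure. f x * ?e x)" .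
  qed simp
  finally show ?thesis
    by (simp add: average_def)
qed

end

section \<open>The Gamma integral\<close>

text \<open>Stopping at t = 1 keeps the variance 2 t within the range s^2 \<le> 2 of the smoothing
  estimate.\<close>

definition time_measure :: "real \<Rightarrow> real measure" where
  "time_measure \<alpha> = density lborel (\<lambda>t. ennreal (indicator {0<..1} t * t powr (\<alpha> - 1) / Gamma \<alpha>))"

lemma sets_time_measure [measurable_cong, simp]: "sets (time_measure \<alpha>) = sets borel"
  by (simp add: time_measure_def)

lemma space_time_measure [simp]: "space (time_measure \<alpha>) = UNIV"
  by (simp add: time_measure_def)

lemma nn_integral_time_measure:
  assumes "0 < \<alpha>" and [measurable]: "h \<in> borel_measurable borel"
  shows "(\<integral>\<^sup>+t. h t \<partial>time_measure \<alpha>) =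
    ennreal (1 / Gamma \<alpha>) * (\<integral>\<^sup>+t. ennreal (t powr (\<alpha> - 1)) * h t * indicator {0<..1} t \<partial>lborel)"
proof -
  have "Gamma \<alpha> > 0" using assms(1) by (rule Gamma_real_pos)
  then have "ennreal (indicator {0<..1} t * t powr (\<alpha> - 1) / Gamma \<alpha>) * h t =
    ennreal (1 / Gamma \<alpha>) * (ennreal (t powr (\<alpha> - 1)) * h t * indicator {0<..1} t)" for t
    by (auto simp: indicator_def ennreal_mult'[symmetric] mult.assoc[symmetric])
  then show ?thesis
    unfolding time_measure_def
    by (subst nn_integral_density) (auto simp: nn_integral_cmult[symmetric])
qed

lemma AE_time_measure: "AE t in time_measure \<alpha>. 0 < t \<and> t \<le> 1"
  unfolding time_measure_def by (subst AE_density) (auto simp: indicator_def)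

lemma nn_integral_powr_Ioc:
  assumes "- 1 < (a :: real)"
  shows "(\<integral>\<^sup>+t. ennreal (t powr a) * indicator {0<..1} t \<partial>lborel) = ennreal (1 / (a + 1))"
proof -
  have "((\<lambda>t. t powr a) has_integral 1 / (a + 1)) {0..1}"
    using has_integral_powr_from_0[of a 1] assms by simp
  then have "(\<integral>\<^sup>+t. ennreal (t powr a) * indicator {0..1} t \<partial>lborel) = ennreal (1 / (a + 1))"
    by (intro nn_integral_has_integral_lebesgue') auto
  also have "(\<integral>\<^sup>+t. ennreal (t powr a) * indicator {0..1} t \<partial>lborel)
      = (\<integral>\<^sup>+t. ennreal (t powr a) * indicator {0<..1} t \<partial>lborel)"
    by (intro nn_integral_cong) (auto simp: indicator_def)
  finally show ?thesis .
qed

text \<open>The condition on \<gamma> enters here for q = \<infinity>: with \<alpha> = \<gamma>/2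
  and \<beta> = d/(2p), the singularity at t = 0 is integrable when \<beta> < \<alpha>.\<close>

lemma nn_integral_time_measure_powr:
  assumes "0 < \<alpha>" "\<beta> < \<alpha>"
  shows "(\<integral>\<^sup>+t. ennreal (t powr - \<beta>) \<partial>time_measure \<alpha>) = ennreal (1 / (Gamma \<alpha> * (\<alpha> - \<beta>)))"
proof -
  have G: "Gamma \<alpha> > 0" using assms(1) by (rule Gamma_real_pos)
  have "(\<integral>\<^sup>+t. ennreal (t powr - \<beta>) \<partial>time_measure \<alpha>) = ennreal (1 / Gamma \<alpha>) *
      (\<integral>\<^sup>+t. ennreal (t powr (\<alpha> - 1 - \<beta>)) * indicator {0<..1} t \<partial>lborel)"
    using assms by (simp add: nn_integral_time_measure ennreal_mult[symmetric] powr_add[symmetric])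
  also have "\<dots> = ennreal (1 / Gamma \<alpha>) * ennreal (1 / (\<alpha> - \<beta>))"
    using assms by (subst nn_integral_powr_Ioc) auto
  also have "\<dots> = ennreal (1 / (Gamma \<alpha> * (\<alpha> - \<beta>)))"
    using assms G by (simp add: ennreal_mult[symmetric])
  finally show ?thesis .
qed

lemma emeasure_time_measure: "0 < \<alpha> \<Longrightarrow> emeasure (time_measure \<alpha>) UNIV = ennreal (1 / (Gamma \<alpha> * \<alpha>))"
proof -
  assume "0 < \<alpha>"
  have "emeasure (time_measure \<alpha>) UNIV = (\<integral>\<^sup>+t. 1 \<partial>time_measure \<alpha>)"
    by simp
  \<comment> \<open>Only almost everywhere, because \<open>0 powr 0\<close> is 0 by
    convention.\<close>
  also have "\<dots> = (\<integral>\<^sup>+t. ennreal (t powr - 0) \<partial>time_measure \<alpha>)"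
    using AE_time_measure[of \<alpha>] by (intro nn_integral_cong_AE) auto
  finally show ?thesis
    using \<open>0 < \<alpha>\<close> nn_integral_time_measure_powr[of \<alpha> 0] by simp
qed

lemma finite_measure_time_measure: "0 < \<alpha> \<Longrightarrow> finite_measure (time_measure \<alpha>)"
  by (rule finite_measureI) (simp add: emeasure_time_measure)

text \<open>Euler's integral for \<open>Gamma\<close> after the substitution of l t for the
  variable.\<close>

lemma nn_integral_powr_exp:
  assumes "0 < \<alpha>" "0 < l"
  shows "(\<integral>\<^sup>+t. ennreal (t powr (\<alpha> - 1) * exp (- (t * l))) * indicator {0<..} t \<partial>lborel)
    = ennreal (Gamma \<alpha> * l powr - \<alpha>)"
proof -
  let ?F = "\<lambda>t::real. ennreal (t powr (\<alpha> - 1) * exp (- (t * l))) * indicator {0<..} t"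
  have "ennreal (Gamma \<alpha>) = (\<integral>\<^sup>+t. ennreal (indicator {0..} t * t powr (\<alpha> - 1) / exp t) \<partial>lborel)"
    by (rule Gamma_conv_nn_integral_real) fact
  also have "\<dots> = ennreal l * (\<integral>\<^sup>+t. ennreal (indicator {0..} (0 + l * t) * (0 + l * t) powr (\<alpha> - 1) / exp (0 + l * t)) \<partial>lborel)"
    using assms by (subst nn_integral_real_affine[where c = l and t = 0]) auto
  also have "(\<integral>\<^sup>+t. ennreal (indicator {0..} (0 + l * t) * (0 + l * t) powr (\<alpha> - 1) / exp (0 + l * t)) \<partial>lborel)
      = (\<integral>\<^sup>+t. ennreal (l powr (\<alpha> - 1)) * ?F t \<partial>lborel)"
    using assms
    by (intro nn_integral_cong)
       (auto simp: indicator_def ennreal_mult[symmetric] powr_mult exp_minus zero_le_mult_iff mult.commute[of l] divide_inverse mult_ac)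
  also have "\<dots> = ennreal (l powr (\<alpha> - 1)) * (\<integral>\<^sup>+t. ?F t \<partial>lborel)"
    by (subst nn_integral_cmult) auto
  finally have "ennreal (Gamma \<alpha>) = ennreal (l powr \<alpha>) * (\<integral>\<^sup>+t. ?F t \<partial>lborel)"
    using assms by (simp add: mult.assoc[symmetric] ennreal_mult[symmetric] powr_diff)
  then have "ennreal (l powr - \<alpha>) * ennreal (Gamma \<alpha>)
      = ennreal (l powr - \<alpha>) * (ennreal (l powr \<alpha>) * (\<integral>\<^sup>+t. ?F t \<partial>lborel))"
    by simp
  also have "\<dots> = (\<integral>\<^sup>+t. ?F t \<partial>lborel)"
    using assms by (simp add: mult.assoc[symmetric] ennreal_mult[symmetric] powr_add[symmetric])
  finally show ?thesis
    using Gamma_real_pos[OF assms(1)] by (simp add: ennreal_mult'[symmetric] mult.commute)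
qed

text \<open>For \<alpha>, l > 0 this is the part t > 1 of the Gamma integral for
  \<open>l powr - \<alpha>\<close>. Writing it as a difference makes the identity of Fourier
  multipliers immediate; the integral form serves only for its size.\<close>

definition heat_remainder :: "real \<Rightarrow> real \<Rightarrow> real" where
  "heat_remainder \<alpha> l = l powr - \<alpha> - (LINT t|time_measure \<alpha>. exp (- (t * l)))"

text \<open>On t > 1 half of the exponent is given to l, where it yields the decay, and half to t,
  where it leaves a Gamma integral at rate 1/2; the latter is the source of
  \<open>2 powr \<alpha>\<close>.\<close>

lemma abs_heat_remainder_le:
  assumes \<alpha>: "0 < \<alpha>" and l: "1 \<le> l"
  shows "\<bar>heat_remainder \<alpha> l\<bar> \<le> 2 powr \<alpha> * exp (- l / 2)"
proof -
  note G = Gamma_real_pos[OF \<alpha>]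
  interpret finite_measure "time_measure \<alpha>" by (rule finite_measure_time_measure[OF \<alpha>])
  let ?F = "\<lambda>t::real. ennreal (t powr (\<alpha> - 1) * exp (- (t * l)))"
  define J where "J = (LINT t|time_measure \<alpha>. exp (- (t * l)))"
  have J0: "0 \<le> J" unfolding J_def by simp
  have "integrable (time_measure \<alpha>) (\<lambda>t. exp (- (t * l)))"
    using AE_time_measure[of \<alpha>] l by (intro integrable_const_bound[of _ 1]) auto
  then have "ennreal J = (\<integral>\<^sup>+t. ennreal (exp (- (t * l))) \<partial>time_measure \<alpha>)"
    unfolding J_def by (subst nn_integral_eq_integral) auto
  also have "\<dots> = ennreal (1 / Gamma \<alpha>) * (\<integral>\<^sup>+t. ?F t * indicator {0<..1} t \<partial>lborel)"
    using \<alpha> by (subst nn_integral_time_measure) (auto simp: ennreal_mult)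
  finally have J: "ennreal J = ennreal (1 / Gamma \<alpha>) * (\<integral>\<^sup>+t. ?F t * indicator {0<..1} t \<partial>lborel)" .
  have "(\<integral>\<^sup>+t. ?F t * indicator {0<..} t \<partial>lborel)
      = (\<integral>\<^sup>+t. ?F t * indicator {0<..1} t + ?F t * indicator {1<..} t \<partial>lborel)"
    by (intro nn_integral_cong) (auto simp: indicator_def)
  also have "\<dots> = (\<integral>\<^sup>+t. ?F t * indicator {0<..1} t \<partial>lborel) + (\<integral>\<^sup>+t. ?F t * indicator {1<..} t \<partial>lborel)"
    by (intro nn_integral_add) auto
  finally have "ennreal (Gamma \<alpha> * l powr - \<alpha>) =
      (\<integral>\<^sup>+t. ?F t * indicator {0<..1} t \<partial>lborel) + (\<integral>\<^sup>+t. ?F t * indicator {1<..} t \<partial>lborel)"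
    using \<alpha> l by (subst (asm) nn_integral_powr_exp) auto
  then have "ennreal (1 / Gamma \<alpha>) * ennreal (Gamma \<alpha> * l powr - \<alpha>) =
      ennreal J + ennreal (1 / Gamma \<alpha>) * (\<integral>\<^sup>+t. ?F t * indicator {1<..} t \<partial>lborel)"
    by (simp add: J distrib_left)
  moreover have "ennreal (1 / Gamma \<alpha>) * ennreal (Gamma \<alpha> * l powr - \<alpha>) = ennreal (l powr - \<alpha>)"
    using G by (simp add: ennreal_mult[symmetric])
  ultimately have eq: "ennreal (l powr - \<alpha>) =
      ennreal J + ennreal (1 / Gamma \<alpha>) * (\<integral>\<^sup>+t. ?F t * indicator {1<..} t \<partial>lborel)"
    by simp
  have "(\<integral>\<^sup>+t. ?F t * indicator {1<..} t \<partial>lborel)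
      \<le> (\<integral>\<^sup>+t. ennreal (exp (- l / 2)) * (ennreal (t powr (\<alpha> - 1) * exp (- (t * (1 / 2)))) * indicator {0<..} t) \<partial>lborel)"
  proof (intro nn_integral_mono)
    fix t :: real
    have "t powr (\<alpha> - 1) * exp (- (t * l)) \<le> exp (- l / 2) * (t powr (\<alpha> - 1) * exp (- (t * (1 / 2))))" if "1 < t"
    proof -
      \<comment> \<open>Adding t l \<ge> t + l - 1 to t l \<ge> 1 gives 2 t l \<ge> t + l.\<close>
      have "0 \<le> (t - 1) * (l - 1)" using l that by simp
      moreover have "1 \<le> t * l" using l that by (smt (verit) mult_le_cancel_left1)
      ultimately have "- (t * l) \<le> - l / 2 + - (t * (1 / 2))" by (simp add: algebra_simps)
      then have "exp (- (t * l)) \<le> exp (- l / 2) * exp (- (t * (1 / 2)))"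
        by (simp only: exp_add[symmetric] exp_le_cancel_iff)
      then have "t powr (\<alpha> - 1) * exp (- (t * l)) \<le> t powr (\<alpha> - 1) * (exp (- l / 2) * exp (- (t * (1 / 2))))"
        by (rule mult_left_mono) simp
      then show ?thesis by (simp only: mult_ac)
    qed
    then show "?F t * indicator {1<..} t
      \<le> ennreal (exp (- l / 2)) * (ennreal (t powr (\<alpha> - 1) * exp (- (t * (1 / 2)))) * indicator {0<..} t)"
      by (auto simp: indicator_def ennreal_mult[symmetric] intro!: ennreal_leI)
  qed
  also have "\<dots> = ennreal (exp (- l / 2)) * ennreal (Gamma \<alpha> * (1 / 2) powr - \<alpha>)"
    using \<alpha> by (subst nn_integral_cmult) (auto simp: nn_integral_powr_exp simp del: mult_1_right times_divide_eq_right)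
  also have "\<dots> = ennreal (Gamma \<alpha>) * ennreal (2 powr \<alpha> * exp (- l / 2))"
    using G by (simp add: ennreal_mult[symmetric] powr_divide powr_minus field_simps)
  finally have "ennreal (1 / Gamma \<alpha>) * (\<integral>\<^sup>+t. ?F t * indicator {1<..} t \<partial>lborel)
      \<le> ennreal (1 / Gamma \<alpha>) * (ennreal (Gamma \<alpha>) * ennreal (2 powr \<alpha> * exp (- l / 2)))"
    by (rule mult_left_mono) simp
  also have "\<dots> = ennreal (2 powr \<alpha> * exp (- l / 2))"
    using G by (simp add: mult.assoc[symmetric] ennreal_mult[symmetric])
  finally have "ennreal (l powr - \<alpha>) \<le> ennreal J + ennreal (2 powr \<alpha> * exp (- l / 2))"
    unfolding eq by (rule add_left_mono)
  then have "l powr - \<alpha> \<le> J + 2 powr \<alpha> * exp (- l / 2)"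
    using J0 by (simp add: ennreal_plus[symmetric] del: ennreal_plus)
  moreover have "ennreal J \<le> ennreal (l powr - \<alpha>)"
    unfolding eq by simp
  then have "J \<le> l powr - \<alpha>" by simp
  ultimately show ?thesis
    by (simp add: heat_remainder_def J_def)
qed

section \<open>Heat averages\<close>

definition heat_measure :: "real \<Rightarrow> (real \<times> (real ^ 'n)) measure" where
  "heat_measure \<alpha> = time_measure \<alpha> \<Otimes>\<^sub>M gauss_measure"

text \<open>With a standard Gaussian second component, each coordinate has variance 2 t, so the
  displacement has the law of the heat kernel at time t.\<close>

definition heat_path :: "real \<times> (real ^ 'n) \<Rightarrow> real ^ 'n" where
  "heat_path w = sqrt (2 * fst w) *\<^sub>R snd w"

text \<open>Taking the norm inside and values in \<open>ennreal\<close> gives a majorant of the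
  complex average that is defined even where the latter diverges.\<close>

definition heat_mean :: "(real ^ 'n \<Rightarrow> complex) \<Rightarrow> real \<Rightarrow> real ^ 'n \<Rightarrow> ennreal" where
  "heat_mean f t x = (\<integral>\<^sup>+z. ennreal (norm (f (x + sqrt (2 * t) *\<^sub>R z))) \<partial>gauss_measure)"

lemma sets_heat_measure [measurable_cong, simp]: "sets (heat_measure \<alpha>) = sets (borel \<Otimes>\<^sub>M borel)"
  unfolding heat_measure_def by (rule sets_pair_measure_cong) simp_all

lemma heat_path_measurable [measurable]: "heat_path \<in> borel_measurable (borel \<Otimes>\<^sub>M borel)"
  unfolding heat_path_def by measurable

lemma sigma_finite_gauss_measure: "sigma_finite_measure (gauss_measure :: 'a::euclidean_space measure)"
proof -
  interpret prob_space "gauss_measure :: 'a measure" by (rule prob_space_gauss_measure)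
  show ?thesis by (rule sigma_finite_measure_axioms)
qed

lemma heat_mean_measurable [measurable]:
  assumes [measurable]: "f \<in> borel_measurable borel"
  shows "(\<lambda>(t, x). heat_mean f t x) \<in> borel_measurable (borel \<Otimes>\<^sub>M borel)"
proof -
  interpret sigma_finite_measure "gauss_measure :: (real ^ 'n) measure" by (rule sigma_finite_gauss_measure)
  show ?thesis unfolding heat_mean_def by measurable
qed

lemma finite_measure_heat_measure:
  assumes "0 < \<alpha>"
  shows "finite_measure (heat_measure \<alpha> :: (real \<times> (real ^ 'n)) measure)"
proof -
  interpret T: finite_measure "time_measure \<alpha>" by (rule finite_measure_time_measure[OF assms])
  interpret N: prob_space "gauss_measure :: (real ^ 'n) measure" by (rule prob_space_gauss_measure)
  show ?thesis
    unfolding heat_measure_def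
    by (rule finite_measureI)
       (simp add: space_pair_measure N.emeasure_pair_measure_Times T.emeasure_eq_measure N.emeasure_eq_measure ennreal_mult_eq_top_iff
          flip: UNIV_Times_UNIV)
qed

lemma nn_integral_heat_measure:
  fixes f :: "real ^ 'n \<Rightarrow> complex"
  assumes [measurable]: "f \<in> borel_measurable borel"
  shows "(\<integral>\<^sup>+w. ennreal (norm (f (x + heat_path w))) \<partial>heat_measure \<alpha>) = (\<integral>\<^sup>+t. heat_mean f t x \<partial>time_measure \<alpha>)"
proof -
  interpret N: sigma_finite_measure "gauss_measure :: (real ^ 'n) measure" by (rule sigma_finite_gauss_measure)
  show ?thesis
    unfolding heat_measure_def heat_mean_def
    by (subst N.nn_integral_fst[symmetric]) (auto simp: heat_path_def)
qed

lemma integral_heat_measure_cis: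
  fixes k :: "real ^ 'n"
  assumes "0 < \<alpha>"
  shows "(LINT w|heat_measure \<alpha>. cis (k \<bullet> heat_path w))
    = of_real (LINT t|time_measure \<alpha>. exp (- (t * (norm k)\<^sup>2)))"
proof -
  interpret T: finite_measure "time_measure \<alpha>" by (rule finite_measure_time_measure[OF assms])
  interpret N: prob_space "gauss_measure :: (real ^ 'n) measure" by (rule prob_space_gauss_measure)
  interpret P: pair_sigma_finite "time_measure \<alpha>" "gauss_measure :: (real ^ 'n) measure" ..
  interpret H: finite_measure "heat_measure \<alpha> :: (real \<times> (real ^ 'n)) measure"
    by (rule finite_measure_heat_measure[OF assms])
  have "integrable (heat_measure \<alpha>) (\<lambda>w. cis (k \<bullet> heat_path w))"
    by (rule H.integrable_const_bound[of _ 1]) auto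
  then have int: "integrable (time_measure \<alpha> \<Otimes>\<^sub>M gauss_measure) (\<lambda>(t, z). cis (k \<bullet> heat_path (t, z)))"
    by (simp add: heat_measure_def case_prod_unfold)
  have "(LINT w|heat_measure \<alpha>. cis (k \<bullet> heat_path w))
      = (LINT t|time_measure \<alpha>. (LINT z|gauss_measure. cis (k \<bullet> heat_path (t, z))))"
    using P.integral_fst'[OF int] by (simp add: heat_measure_def case_prod_unfold)
  \<comment> \<open>An almost-everywhere identity: the square of \<open>sqrt (2 * t)\<close> is 2 t
    only for t \<ge> 0.\<close>
  also have "\<dots> = (LINT t|time_measure \<alpha>. of_real (exp (- (t * (norm k)\<^sup>2))))"
  proof (rule integral_cong_AE)
    show "(\<lambda>t. LINT z|gauss_measure. cis (k \<bullet> heat_path (t, z))) \<in> borel_measurable (time_measure \<alpha>)"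
      by measurable
    show "AE t in time_measure \<alpha>. (LINT z|gauss_measure. cis (k \<bullet> heat_path (t, z))) = of_real (exp (- (t * (norm k)\<^sup>2)))"
      using AE_time_measure[of \<alpha>]
    proof eventually_elim
      case (elim t)
      have "(LINT z|gauss_measure. cis (k \<bullet> heat_path (t, z)))
          = (LINT z|gauss_measure. cis ((sqrt (2 * t) *\<^sub>R k) \<bullet> z))"
        by (simp add: heat_path_def)
      also have "\<dots> = of_real (exp (- (t * (norm k)\<^sup>2)))"
        using elim by (subst integral_gauss_measure_cis) (simp add: power_mult_distrib)
      finally show ?case .
    qed
  qed measurable
  finally show ?thesis by simp
qed

text \<open>Above the level L one writes a = a^(1-p) a^p, and the first factor decreases in a
  because 1 - p \<le> 0.\<close>

lemma le_add_powr_scaled: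
  fixes a L :: real
  assumes "0 \<le> a" "0 < L" "1 \<le> p"
  shows "a \<le> L + L powr (1 - p) * a powr p"
proof (cases "a \<le> L")
  case True
  then show ?thesis by (simp add: add_increasing2)
next
  case False
  then have "a = a powr (1 - p) * a powr p"
    using assms by (simp add: powr_add[symmetric])
  also have "\<dots> \<le> L powr (1 - p) * a powr p"
    using False assms by (intro mult_right_mono powr_mono2') auto
  finally show ?thesis using assms by linarith
qed

text \<open>The smoothing estimate is applied to |f|^p, and the scalar splitting at level L converts
  the resulting bound on the p-th moment into one on the first moment.\<close>

lemma heat_mean_le:
  assumes p: "1 \<le> p"
  obtains C where "0 < C"
    "\<And>(f :: real ^ 'n \<Rightarrow> complex) A t x. f \<in> borel_measurable borel \<Longrightarrow> lattice_periodic f \<Longrightarrow> 0 < A \<Longrightarrow>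
      (\<integral>\<^sup>+x. ennreal (norm (f x) powr p) \<partial>cell_measure) \<le> ennreal (A powr p) \<Longrightarrow> 0 < t \<Longrightarrow> t \<le> 1 \<Longrightarrow>
      heat_mean f t x \<le> ennreal (C * A * t powr - (real CARD('n) / (2 * p)))"
proof -
  obtain C where C: "0 < C"
    "\<And>(P :: real ^ 'n \<Rightarrow> ennreal) s x. P \<in> borel_measurable borel \<Longrightarrow> lattice_periodic P \<Longrightarrow>
      0 < s \<Longrightarrow> s\<^sup>2 \<le> 2 \<Longrightarrow>
      (\<integral>\<^sup>+z. P (x + s *\<^sub>R z) \<partial>gauss_measure)
        \<le> ennreal (C * s powr - real CARD('n)) * (\<integral>\<^sup>+y. P y \<partial>cell_measure)"
    using nn_integral_gauss_measure_periodic_le by blast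
  interpret N: prob_space "gauss_measure :: (real ^ 'n) measure" by (rule prob_space_gauss_measure)
  let ?d = "real CARD('n)"
  have "heat_mean f t x \<le> ennreal ((1 + C) * A * t powr - (?d / (2 * p)))"
    if [measurable]: "f \<in> borel_measurable borel" and f: "lattice_periodic f" and A: "0 < A"
      and fA: "(\<integral>\<^sup>+x. ennreal (norm (f x) powr p) \<partial>cell_measure) \<le> ennreal (A powr p)"
      and t: "0 < t" "t \<le> 1" for f :: "real ^ 'n \<Rightarrow> complex" and A t x
  proof -
    \<comment> \<open>The level at which both terms of the splitting have the same order: the p-th
      moment is at most C t^(-d/2) A^p = C L^p.\<close>
    define L where "L = A * t powr - (?d / (2 * p))"
    have L: "0 < L" using A t by (simp add: L_def)
    let ?I = "\<integral>\<^sup>+z. ennreal (norm (f (x + sqrt (2 * t) *\<^sub>R z)) powr p) \<partial>gauss_measure"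
    have "?I \<le> ennreal (C * sqrt (2 * t) powr - ?d) * (\<integral>\<^sup>+y. ennreal (norm (f y) powr p) \<partial>cell_measure)"
      using t f by (intro C(2)) (auto simp: lattice_periodic_def)
    also have "\<dots> \<le> ennreal (C * sqrt (2 * t) powr - ?d) * ennreal (A powr p)"
      using fA by (rule mult_left_mono) simp
    also have "\<dots> \<le> ennreal (C * t powr - (?d / 2)) * ennreal (A powr p)"
    proof (intro mult_right_mono ennreal_leI mult_left_mono)
      have "sqrt (2 * t) powr - ?d = (2 * t) powr - (?d / 2)"
        using t by (simp add: powr_half_sqrt[symmetric] powr_powr)
      also have "\<dots> \<le> t powr - (?d / 2)"
        using t by (intro powr_mono2') auto
      finally show "sqrt (2 * t) powr - ?d \<le> t powr - (?d / 2)" .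
    qed (use C(1) in auto)
    finally have I: "?I \<le> ennreal (C * t powr - (?d / 2) * A powr p)"
      using C(1) by (simp add: ennreal_mult)
    have "heat_mean f t x \<le> (\<integral>\<^sup>+z. ennreal L + ennreal (L powr (1 - p)) *
        ennreal (norm (f (x + sqrt (2 * t) *\<^sub>R z)) powr p) \<partial>gauss_measure)"
      unfolding heat_mean_def
    proof (intro nn_integral_mono)
      fix z
      have "norm (f (x + sqrt (2 * t) *\<^sub>R z)) \<le> L + L powr (1 - p) * norm (f (x + sqrt (2 * t) *\<^sub>R z)) powr p"
        using L p by (intro le_add_powr_scaled) auto
      then show "ennreal (norm (f (x + sqrt (2 * t) *\<^sub>R z)))
          \<le> ennreal L + ennreal (L powr (1 - p)) * ennreal (norm (f (x + sqrt (2 * t) *\<^sub>R z)) powr p)"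
        using L by (simp add: ennreal_mult[symmetric] ennreal_plus[symmetric] ennreal_leI del: ennreal_plus)
    qed
    also have "\<dots> = ennreal L + ennreal (L powr (1 - p)) * ?I"
      using N.emeasure_space_1 by (subst nn_integral_add) (auto simp: nn_integral_cmult)
    also have "\<dots> \<le> ennreal L + ennreal (L powr (1 - p)) * ennreal (C * t powr - (?d / 2) * A powr p)"
      using I by (intro add_left_mono mult_left_mono) auto
    also have "\<dots> = ennreal (L + L powr (1 - p) * (C * t powr - (?d / 2) * A powr p))"
      using L C(1) by (simp add: ennreal_mult[symmetric] ennreal_plus[symmetric] del: ennreal_plus)
    also have "L powr (1 - p) * (C * t powr - (?d / 2) * A powr p) = C * L"
    proof -
      have "L powr (1 - p) * t powr - (?d / 2) * A powr p
          = (A powr (1 - p) * A powr p) * (t powr (- (?d / (2 * p)) * (1 - p)) * t powr - (?d / 2))"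
        using A t by (simp add: L_def powr_mult powr_powr)
      also have "\<dots> = A * t powr (- (?d / (2 * p)) * (1 - p) + - (?d / 2))"
        using A by (simp only: powr_add[symmetric]) simp
      also have "- (?d / (2 * p)) * (1 - p) + - (?d / 2) = - (?d / (2 * p))"
        using p by (simp add: field_simps)
      finally show ?thesis by (simp add: L_def mult_ac)
    qed
    finally show ?thesis by (simp add: L_def algebra_simps)
  qed
  with C(1) that[of "1 + C"] show ?thesis by auto
qed

text \<open>Valid without integrability, because a Bochner integral that does not exist has the
  value 0.\<close>

lemma norm_integral_le_enn2real_nn_integral:
  fixes h :: "'a \<Rightarrow> 'b::{banach, second_countable_topology}"
  shows "norm (integral\<^sup>L M h) \<le> enn2real (\<integral>\<^sup>+x. ennreal (norm (h x)) \<partial>M)"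
proof (cases "integrable M h")
  case True
  then have "(\<integral>\<^sup>+x. ennreal (norm (h x)) \<partial>M) = ennreal (LINT x|M. norm (h x))"
    by (intro nn_integral_eq_integral) auto
  then show ?thesis
    using integral_norm_bound[of M h] by simp
next
  case False
  then show ?thesis by (simp add: not_integrable_integral_eq)
qed

lemma heat_average_sup_bound:
  assumes p: "1 \<le> p" and \<alpha>: "real CARD('n) / (2 * p) < \<alpha>"
  obtains C where "0 < C"
    "\<And>(f :: real ^ 'n \<Rightarrow> complex) A x. f \<in> borel_measurable borel \<Longrightarrow> lattice_periodic f \<Longrightarrow> 0 < A \<Longrightarrow>
      (\<integral>\<^sup>+x. ennreal (norm (f x) powr p) \<partial>cell_measure) \<le> ennreal (A powr p) \<Longrightarrow>
      norm (LINT w|heat_measure \<alpha>. f (x + heat_path w)) \<le> C * A"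
proof -
  let ?\<beta> = "real CARD('n) / (2 * p)"
  have \<alpha>0: "0 < \<alpha>" using \<alpha> p by (smt (verit) divide_nonneg_nonneg of_nat_0_le_iff)
  obtain C where C: "0 < C"
    "\<And>(f :: real ^ 'n \<Rightarrow> complex) A t x. f \<in> borel_measurable borel \<Longrightarrow> lattice_periodic f \<Longrightarrow> 0 < A \<Longrightarrow>
      (\<integral>\<^sup>+x. ennreal (norm (f x) powr p) \<partial>cell_measure) \<le> ennreal (A powr p) \<Longrightarrow> 0 < t \<Longrightarrow> t \<le> 1 \<Longrightarrow>
      heat_mean f t x \<le> ennreal (C * A * t powr - (real CARD('n) / (2 * p)))"
    using heat_mean_le[OF p] by blast
  define K where "K = 1 / (Gamma \<alpha> * (\<alpha> - ?\<beta>))"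
  have K: "0 < K" using \<alpha> Gamma_real_pos[OF \<alpha>0] by (simp add: K_def)
  have "norm (LINT w|heat_measure \<alpha>. f (x + heat_path w)) \<le> C * K * A"
    if [measurable]: "f \<in> borel_measurable borel" and f: "lattice_periodic f" and A: "0 < A"
      and fA: "(\<integral>\<^sup>+x. ennreal (norm (f x) powr p) \<partial>cell_measure) \<le> ennreal (A powr p)"
    for f :: "real ^ 'n \<Rightarrow> complex" and A x
  proof -
    have "(\<integral>\<^sup>+w. ennreal (norm (f (x + heat_path w))) \<partial>heat_measure \<alpha>) = (\<integral>\<^sup>+t. heat_mean f t x \<partial>time_measure \<alpha>)"
      by (rule nn_integral_heat_measure) measurable
    also have "\<dots> \<le> (\<integral>\<^sup>+t. ennreal (C * A) * ennreal (t powr - ?\<beta>) \<partial>time_measure \<alpha>)"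
      using AE_time_measure[of \<alpha>] C(1) A
      by (intro nn_integral_mono_AE, elim eventually_mono)
         (use C(2)[OF that] in \<open>auto simp: ennreal_mult[symmetric]\<close>)
    also have "\<dots> = ennreal (C * A) * ennreal K"
      using \<alpha> \<alpha>0 by (subst nn_integral_cmult) (auto simp: nn_integral_time_measure_powr K_def)
    also have "\<dots> = ennreal (C * K * A)"
      using C(1) A K by (simp add: ennreal_mult[symmetric] mult_ac)
    finally have "enn2real (\<integral>\<^sup>+w. ennreal (norm (f (x + heat_path w))) \<partial>heat_measure \<alpha>) \<le> C * K * A"
      using C(1) A K by (simp add: enn2real_leI)
    then show ?thesis
      using norm_integral_le_enn2real_nn_integral[of "heat_measure \<alpha>" "\<lambda>w. f (x + heat_path w)"] by linarith
  qed
  with C(1) K that[of "C * K"] show ?thesis by auto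
qed

text \<open>Jensen's inequality up to a constant, obtained by integrating
  \<open>h \<le> L + L\<^bsup>1-q\<^esup> h\<^bsup>q\<^esup>\<close> with \<open>L\<close> half the mean of \<open>h\<close>.\<close>

lemma nn_integral_powr_le:
  fixes h :: "'a \<Rightarrow> real"
  assumes M: "emeasure M (space M) = ennreal m" and m: "0 < m" and q: "1 \<le> q"
    and [measurable]: "h \<in> borel_measurable M" and h: "\<And>x. 0 \<le> h x"
  shows "ennreal (enn2real (\<integral>\<^sup>+x. ennreal (h x) \<partial>M) powr q)
    \<le> ennreal (2 powr q * m powr (q - 1)) * (\<integral>\<^sup>+x. ennreal (h x powr q) \<partial>M)"
proof -
  define H where "H = enn2real (\<integral>\<^sup>+x. ennreal (h x) \<partial>M)"
  let ?K = "\<integral>\<^sup>+x. ennreal (h x powr q) \<partial>M"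
  have c: "0 < 2 powr q * m powr (q - 1)" using m by simp
  \<comment> \<open>An infinite integral of \<open>h\<close> falls under H = 0, since
    \<open>enn2real\<close> sends infinity to 0; hence H > 0 entails finiteness.\<close>
  consider "H = 0" | "?K = \<infinity>" | "0 < H" "?K \<noteq> \<infinity>"
    unfolding H_def by (metis enn2real_nonneg order_le_less)
  then show ?thesis
  proof cases
    case 1
    then show ?thesis by (simp add: H_def[symmetric])
  next
    case 2
    have "ennreal (2 powr q * m powr (q - 1)) * ?K = \<infinity>"
      unfolding 2 using m by (simp add: ennreal_mult_eq_top_iff)
    then show ?thesis by simp
  next
    case 3
    then obtain K where K: "?K = ennreal K" "0 \<le> K" by (cases ?K) auto
    have H: "(\<integral>\<^sup>+x. ennreal (h x) \<partial>M) = ennreal H"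
      using 3(1) unfolding H_def by (cases "\<integral>\<^sup>+x. ennreal (h x) \<partial>M") auto
    define L where "L = H / (2 * m)"
    have L: "0 < L" using 3 m by (simp add: L_def)
    have "ennreal H \<le> (\<integral>\<^sup>+x. ennreal L + ennreal (L powr (1 - q)) * ennreal (h x powr q) \<partial>M)"
      unfolding H[symmetric] using le_add_powr_scaled[OF h L q] L
      by (intro nn_integral_mono) (simp add: ennreal_mult[symmetric] ennreal_plus[symmetric] ennreal_leI del: ennreal_plus)
    also have "\<dots> = ennreal L * ennreal m + ennreal (L powr (1 - q)) * ennreal K"
      by (subst nn_integral_add) (auto simp: nn_integral_cmult K M)
    also have "\<dots> = ennreal (L * m + L powr (1 - q) * K)"
      using L K m by (simp add: ennreal_mult[symmetric] ennreal_plus[symmetric] del: ennreal_plus)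
    finally have "H \<le> L * m + L powr (1 - q) * K"
      using L K m by (subst (asm) ennreal_le_iff) auto
    \<comment> \<open>Half of H is absorbed on the left, which is why L is half the mean.\<close>
    moreover have "L * m = H / 2" using m by (simp add: L_def)
    ultimately have "H / 2 \<le> L powr (1 - q) * K" by simp
    then have "(2 powr q * m powr (q - 1) * L powr (q - 1)) * (H / 2)
        \<le> (2 powr q * m powr (q - 1) * L powr (q - 1)) * (L powr (1 - q) * K)"
      by (rule mult_left_mono) simp
    also have "\<dots> = 2 powr q * m powr (q - 1) * (L powr (q - 1) * L powr (1 - q)) * K"
      by (simp only: mult_ac)
    also have "L powr (q - 1) * L powr (1 - q) = 1"
      using L by (simp add: powr_add[symmetric])
    also have "(2 powr q * m powr (q - 1) * L powr (q - 1)) * (H / 2) = H powr q"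
    proof -
      have "m powr (q - 1) * L powr (q - 1) = (H / 2) powr (q - 1)"
        using m L by (simp add: powr_mult[symmetric] L_def)
      then have "(2 powr q * m powr (q - 1) * L powr (q - 1)) * (H / 2)
          = 2 powr q * ((H / 2) powr (q - 1) * (H / 2) powr 1)"
        using 3 by (simp add: mult.assoc)
      also have "\<dots> = 2 powr q * (H / 2) powr q"
        by (simp only: powr_add[symmetric]) simp
      also have "\<dots> = (2 * (H / 2)) powr q" using 3 by (subst powr_mult) auto
      finally show ?thesis by simp
    qed
    finally have "H powr q \<le> 2 powr q * m powr (q - 1) * K" by simp
    then show ?thesis
      using c K by (simp add: H_def[symmetric] ennreal_mult[symmetric] ennreal_leI)
  qed
qed

text \<open>After Fubini, translation invariance applies to each displacement separately and the
  Gaussian has mass one.\<close>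

lemma nn_integral_heat_mean:
  fixes f :: "real ^ 'n \<Rightarrow> complex"
  assumes [measurable]: "f \<in> borel_measurable borel" and f: "lattice_periodic f"
  shows "(\<integral>\<^sup>+x. heat_mean f t x \<partial>cell_measure) = (\<integral>\<^sup>+x. ennreal (norm (f x)) \<partial>cell_measure)"
proof -
  interpret N: prob_space "gauss_measure :: (real ^ 'n) measure" by (rule prob_space_gauss_measure)
  interpret P: pair_sigma_finite "cell_measure :: (real ^ 'n) measure" "gauss_measure :: (real ^ 'n) measure" ..
  have "(\<integral>\<^sup>+x. heat_mean f t x \<partial>cell_measure)
      = (\<integral>\<^sup>+z. (\<integral>\<^sup>+x. ennreal (norm (f (x + sqrt (2 * t) *\<^sub>R z))) \<partial>cell_measure) \<partial>gauss_measure)"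
    unfolding heat_mean_def by (rule P.Fubini'[symmetric]) measurable
  also have "\<dots> = (\<integral>\<^sup>+z. (\<integral>\<^sup>+x. ennreal (norm (f x)) \<partial>cell_measure) \<partial>(gauss_measure :: (real ^ 'n) measure))"
    using f by (intro nn_integral_cong nn_integral_cell_measure_shift) (auto simp: lattice_periodic_def)
  finally show ?thesis
    using N.emeasure_space_1 by simp
qed

text \<open>Moves the factor t^(\<alpha>-\<epsilon>) from the measure to the integrand, where it
  will be raised to the power q together with the heat average.\<close>

lemma nn_integral_time_measure_change:
  assumes "0 < \<alpha>" "0 < \<epsilon>" and [measurable]: "h \<in> borel_measurable borel"
  shows "(\<integral>\<^sup>+t. h t \<partial>time_measure \<alpha>)
    = ennreal (Gamma \<epsilon> / Gamma \<alpha>) * (\<integral>\<^sup>+t. ennreal (t powr (\<alpha> - \<epsilon>)) * h t \<partial>time_measure \<epsilon>)"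
proof -
  note G = Gamma_real_pos[OF assms(1)] Gamma_real_pos[OF assms(2)]
  have "(\<integral>\<^sup>+t. ennreal (t powr (\<alpha> - \<epsilon>)) * h t \<partial>time_measure \<epsilon>)
      = ennreal (1 / Gamma \<epsilon>) * (\<integral>\<^sup>+t. ennreal (t powr (\<epsilon> - 1)) * (ennreal (t powr (\<alpha> - \<epsilon>)) * h t) * indicator {0<..1} t \<partial>lborel)"
    using assms by (subst nn_integral_time_measure) auto
  also have "\<dots> = ennreal (1 / Gamma \<epsilon>) * (\<integral>\<^sup>+t. ennreal (t powr (\<alpha> - 1)) * h t * indicator {0<..1} t \<partial>lborel)"
    by (simp add: mult.assoc[symmetric] ennreal_mult[symmetric] powr_add[symmetric])
  finally have "ennreal (Gamma \<epsilon> / Gamma \<alpha>) * (\<integral>\<^sup>+t. ennreal (t powr (\<alpha> - \<epsilon>)) * h t \<partial>time_measure \<epsilon>)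
      = (ennreal (Gamma \<epsilon> / Gamma \<alpha>) * ennreal (1 / Gamma \<epsilon>)) *
        (\<integral>\<^sup>+t. ennreal (t powr (\<alpha> - 1)) * h t * indicator {0<..1} t \<partial>lborel)"
    by (simp add: mult.assoc)
  also have "ennreal (Gamma \<epsilon> / Gamma \<alpha>) * ennreal (1 / Gamma \<epsilon>) = ennreal (1 / Gamma \<alpha>)"
    using G by (simp add: ennreal_mult[symmetric])
  finally show ?thesis
    using assms by (simp add: nn_integral_time_measure)
qed

text \<open>Jensen over \<open>time_measure \<epsilon>\<close> leaves (t^\<theta> v)^q with v the
  heat average. Its factor v^(q-1) is at most a constant times (A t^(-d/2))^(q-1), which the factor
  t^(\<theta> q) cancels exactly. The remaining v has cell integral at most A for every t, and the
  hypothesis on \<alpha> says that \<epsilon> = \<alpha> - \<theta> is positive, so the time measure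
  is finite.\<close>

lemma heat_average_Lq_bound:
  assumes q: "1 < q" and \<alpha>: "real CARD('n) / 2 * (1 - 1 / q) < \<alpha>"
  obtains C where "0 < C"
    "\<And>(f :: real ^ 'n \<Rightarrow> complex) A. f \<in> borel_measurable borel \<Longrightarrow> lattice_periodic f \<Longrightarrow> 0 < A \<Longrightarrow>
      (\<integral>\<^sup>+x. ennreal (norm (f x)) \<partial>cell_measure) \<le> ennreal A \<Longrightarrow>
      (\<integral>\<^sup>+x. ennreal (norm (LINT w|heat_measure \<alpha>. f (x + heat_path w)) powr q) \<partial>cell_measure)
        \<le> ennreal ((C * A) powr q)"
proof -
  let ?d = "real CARD('n)"
  define \<theta> where "\<theta> = ?d / 2 * (1 - 1 / q)"
  have \<theta>: "0 \<le> \<theta>" "\<theta> * q = ?d / 2 * (q - 1)"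
    using q by (simp_all add: \<theta>_def field_simps)
  define \<epsilon> where "\<epsilon> = \<alpha> - \<theta>"
  have \<epsilon>: "0 < \<epsilon>" and \<alpha>0: "0 < \<alpha>"
    using \<alpha> \<theta> by (auto simp: \<epsilon>_def \<theta>_def)
  define c where "c = Gamma \<epsilon> / Gamma \<alpha>"
  define m where "m = 1 / (Gamma \<epsilon> * \<epsilon>)"
  have cm: "0 < c" "0 < m"
    using Gamma_real_pos[OF \<alpha>0] Gamma_real_pos[OF \<epsilon>] \<epsilon> by (auto simp: c_def m_def)
  have U: "emeasure (time_measure \<epsilon>) UNIV = ennreal m"
    using emeasure_time_measure[OF \<epsilon>] by (simp add: m_def)
  interpret U: finite_measure "time_measure \<epsilon>" by (rule finite_measure_time_measure[OF \<epsilon>])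
  interpret P: pair_sigma_finite "cell_measure :: (real ^ 'n) measure" "time_measure \<epsilon>" ..
  obtain B where B: "0 < B"
    "\<And>(f :: real ^ 'n \<Rightarrow> complex) A t x. f \<in> borel_measurable borel \<Longrightarrow> lattice_periodic f \<Longrightarrow> 0 < A \<Longrightarrow>
      (\<integral>\<^sup>+x. ennreal (norm (f x) powr 1) \<partial>cell_measure) \<le> ennreal (A powr 1) \<Longrightarrow> 0 < t \<Longrightarrow> t \<le> 1 \<Longrightarrow>
      heat_mean f t x \<le> ennreal (B * A * t powr - (?d / (2 * 1)))"
    using heat_mean_le[of 1] by blast
  \<comment> \<open>The q-th root of c^q (change of time measure), times 2^q m^(q-1) (Jensen), times
    B^(q-1) (supremum bound), times m (mass of the time measure).\<close>
  define C where "C = 2 * c * m * B powr ((q - 1) / q)"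
  have C: "0 < C" using cm B(1) by (simp add: C_def)
  have "(\<integral>\<^sup>+x. ennreal (norm (LINT w|heat_measure \<alpha>. f (x + heat_path w)) powr q) \<partial>cell_measure)
        \<le> ennreal ((C * A) powr q)"
    if [measurable]: "f \<in> borel_measurable borel" and f: "lattice_periodic f" and A: "0 < A"
      and fA: "(\<integral>\<^sup>+x. ennreal (norm (f x)) \<partial>cell_measure) \<le> ennreal A"
    for f :: "real ^ 'n \<Rightarrow> complex" and A
  proof -
    \<comment> \<open>\<open>powr\<close> needs real values; nothing is lost on (0,1], where the
      heat average is finite.\<close>
    define v where "v t x = enn2real (heat_mean f t x)" for t x
    have [measurable]: "(\<lambda>(t, x). v t x) \<in> borel_measurable (borel \<Otimes>\<^sub>M borel)"
      using heat_mean_measurable[of f] unfolding v_def by measurable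
    have [measurable]: "(\<lambda>t. heat_mean f t x) \<in> borel_measurable borel" for x
      using measurable_compose[OF _ heat_mean_measurable[of f], of "\<lambda>t. (t, x)" borel] by simp
    have [measurable]: "(\<lambda>t. v t x) \<in> borel_measurable borel" for x
      unfolding v_def by measurable
    have v0: "0 \<le> v t x" for t x by (simp add: v_def)
    have vle: "heat_mean f t x = ennreal (v t x)" "v t x \<le> B * A * t powr - (?d / 2)"
      if "0 < t" "t \<le> 1" for t x
    proof -
      have "heat_mean f t x \<le> ennreal (B * A * t powr - (?d / 2))"
        using B(2)[OF _ f A _ that] fA A by simp
      then show "heat_mean f t x = ennreal (v t x)" "v t x \<le> B * A * t powr - (?d / 2)"
        using B(1) A by (auto simp: v_def enn2real_leI ennreal_enn2real_if top_unique)
    qed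
    have pt: "ennreal (norm (LINT w|heat_measure \<alpha>. f (x + heat_path w)) powr q)
      \<le> ennreal (c powr q * (2 powr q * m powr (q - 1)) * (B * A) powr (q - 1)) * (\<integral>\<^sup>+t. heat_mean f t x \<partial>time_measure \<epsilon>)"
      for x
    proof -
      let ?H = "\<integral>\<^sup>+t. ennreal (t powr \<theta> * v t x) \<partial>time_measure \<epsilon>"
      have "(\<integral>\<^sup>+w. ennreal (norm (f (x + heat_path w))) \<partial>heat_measure \<alpha>) = (\<integral>\<^sup>+t. heat_mean f t x \<partial>time_measure \<alpha>)"
        by (rule nn_integral_heat_measure) measurable
      also have "\<dots> = ennreal c * (\<integral>\<^sup>+t. ennreal (t powr \<theta>) * heat_mean f t x \<partial>time_measure \<epsilon>)"
        using nn_integral_time_measure_change[OF \<alpha>0 \<epsilon>, of "\<lambda>t. heat_mean f t x"] by (simp add: c_def \<epsilon>_def)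
      also have "(\<integral>\<^sup>+t. ennreal (t powr \<theta>) * heat_mean f t x \<partial>time_measure \<epsilon>) = ?H"
        using AE_time_measure[of \<epsilon>]
        by (intro nn_integral_cong_AE, elim eventually_mono) (auto simp: vle ennreal_mult[symmetric] v0)
      finally have "norm (LINT w|heat_measure \<alpha>. f (x + heat_path w)) \<le> c * enn2real ?H"
        using norm_integral_le_enn2real_nn_integral[of "heat_measure \<alpha>" "\<lambda>w. f (x + heat_path w)"] cm
        by (simp add: enn2real_mult)
      then have "norm (LINT w|heat_measure \<alpha>. f (x + heat_path w)) powr q \<le> (c * enn2real ?H) powr q"
        using q by (intro powr_mono2) auto
      then have "norm (LINT w|heat_measure \<alpha>. f (x + heat_path w)) powr q \<le> c powr q * enn2real ?H powr q"
        using cm by (simp add: powr_mult)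
      then have "ennreal (norm (LINT w|heat_measure \<alpha>. f (x + heat_path w)) powr q)
          \<le> ennreal (c powr q) * ennreal (enn2real ?H powr q)"
        by (simp add: ennreal_mult[symmetric] ennreal_leI)
      also have "\<dots> \<le> ennreal (c powr q) * (ennreal (2 powr q * m powr (q - 1)) *
          (\<integral>\<^sup>+t. ennreal ((t powr \<theta> * v t x) powr q) \<partial>time_measure \<epsilon>))"
        using q cm v0 U by (intro mult_left_mono nn_integral_powr_le) auto
      also have "(\<integral>\<^sup>+t. ennreal ((t powr \<theta> * v t x) powr q) \<partial>time_measure \<epsilon>)
          \<le> (\<integral>\<^sup>+t. ennreal ((B * A) powr (q - 1)) * heat_mean f t x \<partial>time_measure \<epsilon>)"
      proof (rule nn_integral_mono_AE, use AE_time_measure[of \<epsilon>] in eventually_elim)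
        case (elim t)
        \<comment> \<open>One factor of v is kept for the integration over the cell; the other q - 1
          powers go to the supremum bound.\<close>
        have "(t powr \<theta> * v t x) powr q = t powr (\<theta> * q) * (v t x powr (q - 1) * v t x)"
          using v0[of t x] powr_add[of "v t x" "q - 1" 1]
          by (cases "v t x = 0") (auto simp: powr_mult powr_powr)
        also have "\<dots> \<le> t powr (\<theta> * q) * ((B * A * t powr - (?d / 2)) powr (q - 1) * v t x)"
          using q elim vle v0 by (intro mult_left_mono mult_right_mono powr_mono2) auto
        also have "\<dots> = (B * A) powr (q - 1) * (t powr (\<theta> * q) * t powr (- (?d / 2) * (q - 1))) * v t x"
          using B(1) A elim by (simp add: powr_mult powr_powr mult_ac)
        also have "t powr (\<theta> * q) * t powr (- (?d / 2) * (q - 1)) = 1"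
          using elim by (simp add: powr_add[symmetric] \<theta>(2))
        finally have "(t powr \<theta> * v t x) powr q \<le> (B * A) powr (q - 1) * v t x" by simp
        then show ?case
          using elim vle v0 by (simp add: ennreal_mult[symmetric] ennreal_leI)
      qed
      also have "\<dots> = ennreal ((B * A) powr (q - 1)) * (\<integral>\<^sup>+t. heat_mean f t x \<partial>time_measure \<epsilon>)"
        by (subst nn_integral_cmult) auto
      finally show ?thesis
        by (simp add: ennreal_mult mult_left_mono mult.assoc)
    qed
    have "(\<integral>\<^sup>+x. ennreal (norm (LINT w|heat_measure \<alpha>. f (x + heat_path w)) powr q) \<partial>cell_measure)
      \<le> (\<integral>\<^sup>+x. ennreal (c powr q * (2 powr q * m powr (q - 1)) * (B * A) powr (q - 1)) *
          (\<integral>\<^sup>+t. heat_mean f t x \<partial>time_measure \<epsilon>) \<partial>cell_measure)"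
      by (intro nn_integral_mono pt)
    also have "\<dots> = ennreal (c powr q * (2 powr q * m powr (q - 1)) * (B * A) powr (q - 1)) *
        (\<integral>\<^sup>+x. (\<integral>\<^sup>+t. heat_mean f t x \<partial>time_measure \<epsilon>) \<partial>cell_measure)"
    proof (rule nn_integral_cmult)
      show "(\<lambda>x. \<integral>\<^sup>+t. heat_mean f t x \<partial>time_measure \<epsilon>) \<in> borel_measurable cell_measure"
        using heat_mean_measurable[of f] by measurable
    qed
    also have "(\<integral>\<^sup>+x. (\<integral>\<^sup>+t. heat_mean f t x \<partial>time_measure \<epsilon>) \<partial>cell_measure)
        = (\<integral>\<^sup>+t. (\<integral>\<^sup>+x. heat_mean f t x \<partial>cell_measure) \<partial>time_measure \<epsilon>)"
      using heat_mean_measurable[of f] by (intro P.Fubini'[symmetric]) measurable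
    also have "\<dots> = (\<integral>\<^sup>+x. ennreal (norm (f x)) \<partial>cell_measure) * ennreal m"
      using f U by (simp add: nn_integral_heat_mean)
    also have "\<dots> \<le> ennreal A * ennreal m"
      using fA by (rule mult_right_mono) simp
    finally have "(\<integral>\<^sup>+x. ennreal (norm (LINT w|heat_measure \<alpha>. f (x + heat_path w)) powr q) \<partial>cell_measure)
        \<le> ennreal (c powr q * (2 powr q * m powr (q - 1)) * (B * A) powr (q - 1)) * (ennreal A * ennreal m)"
      by (simp add: mult_left_mono)
    also have "\<dots> = ennreal ((c powr q * 2 powr q * (m powr (q - 1) * m) * B powr (q - 1)) * (A powr (q - 1) * A))"
      using A B(1) cm by (simp add: ennreal_mult[symmetric] powr_mult mult_ac)
    also have "m powr (q - 1) * m = m powr q"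
      using cm powr_add[of m "q - 1" 1] by simp
    also have "A powr (q - 1) * A = A powr q"
      using A powr_add[of A "q - 1" 1] by simp
    also have "c powr q * 2 powr q * m powr q * B powr (q - 1) * A powr q = (C * A) powr q"
      using A B(1) cm q by (simp add: C_def powr_mult powr_powr)
    finally show ?thesis .
  qed
  with C that show ?thesis by blast
qed

section \<open>Riesz potentials\<close>

definition cell_coeff :: "(real ^ 'n \<Rightarrow> complex) \<Rightarrow> int ^ 'n \<Rightarrow> complex" where
  "cell_coeff f k = (LINT x|cell_measure. f x * cis (- (real_freq k \<bullet> x))) / of_real ((2 * pi) ^ CARD('n))"

text \<open>The zero frequency is excluded because the part t > 1 of the Gamma integral diverges
  there.\<close>

definition remainder_coeff :: "real \<Rightarrow> (real ^ 'n \<Rightarrow> complex) \<Rightarrow> int ^ 'n \<Rightarrow> complex" where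
  "remainder_coeff \<alpha> f k =
    (if k = 0 then 0 else of_real (heat_remainder \<alpha> ((norm (real_freq k))\<^sup>2)) * cell_coeff f k)"

definition remainder_series :: "real \<Rightarrow> (real ^ 'n \<Rightarrow> complex) \<Rightarrow> real ^ 'n \<Rightarrow> complex" where
  "remainder_series \<alpha> f x = (LINT k|count_space UNIV. remainder_coeff \<alpha> f k * cis (real_freq k \<bullet> x))"

text \<open>For integrable periodic Borel f of mean zero and \<alpha> > 0 this is the operator of
  order - 2 \<alpha>, so it is used with \<alpha> = \<gamma>/2.\<close>

definition riesz_potential :: "real \<Rightarrow> (real ^ 'n \<Rightarrow> complex) \<Rightarrow> real ^ 'n \<Rightarrow> complex" where
  "riesz_potential \<alpha> f x = (LINT w|heat_measure \<alpha>. f (x + heat_path w)) + remainder_series \<alpha> f x"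

lemma norm_real_freq_ge_1:
  assumes "k \<noteq> 0"
  shows "1 \<le> norm (real_freq k)"
proof -
  obtain i where i: "k $ i \<noteq> 0" using assms by (auto simp: vec_eq_iff)
  then have "1 \<le> \<bar>real_of_int (k $ i)\<bar>" by linarith
  also have "\<dots> = \<bar>real_freq k $ i\<bar>" by (simp add: real_freq_def)
  also have "\<dots> \<le> norm (real_freq k)" by (rule component_le_norm_cart)
  finally show ?thesis .
qed

lemma norm_cell_coeff_le:
  fixes f :: "real ^ 'n \<Rightarrow> complex"
  shows "norm (cell_coeff f k) \<le> (LINT x|cell_measure. norm (f x)) / (2 * pi) ^ CARD('n)"
  unfolding cell_coeff_def norm_divide
  using integral_norm_bound[of cell_measure "\<lambda>x. f x * cis (- (real_freq k \<bullet> x))"]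
  by (simp add: norm_mult norm_power divide_right_mono del: power_mult_distrib)

text \<open>The Fourier coefficients are bounded by the L_1 norm over the volume, and
  \<open>heat_remainder\<close> contributes exp(- |k|^2 / 2), whose lattice sum is finite.\<close>

lemma remainder_coeff_summable:
  assumes \<alpha>: "0 < \<alpha>"
  obtains C where "0 < C"
    "\<And>f :: real ^ 'n \<Rightarrow> complex. integrable (count_space UNIV) (remainder_coeff \<alpha> f)"
    "\<And>f :: real ^ 'n \<Rightarrow> complex. (LINT k|count_space UNIV. norm (remainder_coeff \<alpha> f k)) \<le> C * (LINT x|cell_measure. norm (f x))"
proof -
  \<comment> \<open>The rate 1/(8 \<pi>^2) undoes the factor 2 \<pi> in
    \<open>lattice_shift\<close>: applied to |2 \<pi> k|^2 it gives |k|^2 / 2.\<close>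
  obtain S where S: "0 < S"
    "\<And>Y :: int ^ 'n \<Rightarrow> real ^ 'n. (\<And>k. Y k \<in> fund_cell) \<Longrightarrow>
      (\<integral>\<^sup>+k. ennreal (exp (- (1 / (8 * pi\<^sup>2)) * (norm (Y k + lattice_shift k))\<^sup>2)) \<partial>count_space UNIV) \<le> ennreal S"
    using lattice_gauss_sum_bound[of "1 / (8 * pi\<^sup>2)"] by (auto simp: zero_less_mult_iff)
  define D where "D = (2 * pi) ^ CARD('n)"
  have D: "0 < D" by (simp add: D_def)
  have bound: "(\<integral>\<^sup>+k. ennreal (norm (remainder_coeff \<alpha> f k)) \<partial>count_space UNIV)
      \<le> ennreal (2 powr \<alpha> / D * S * (LINT x|cell_measure. norm (f x)))" for f :: "real ^ 'n \<Rightarrow> complex"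
  proof -
    let ?I = "LINT x|cell_measure. norm (f x)"
    have I: "0 \<le> ?I" by simp
    have "(\<integral>\<^sup>+k. ennreal (norm (remainder_coeff \<alpha> f k)) \<partial>count_space UNIV)
        \<le> (\<integral>\<^sup>+k. ennreal (2 powr \<alpha> / D * ?I) *
            ennreal (exp (- (1 / (8 * pi\<^sup>2)) * (norm ((0 :: real ^ 'n) + lattice_shift k))\<^sup>2)) \<partial>count_space UNIV)"
    proof (intro nn_integral_mono)
      fix k :: "int ^ 'n"
      have e: "exp (- (1 / (8 * pi\<^sup>2)) * (norm ((0 :: real ^ 'n) + lattice_shift k))\<^sup>2) = exp (- (norm (real_freq k))\<^sup>2 / 2)"
        by (simp add: lattice_shift_def power_mult_distrib)
      have "norm (remainder_coeff \<alpha> f k) \<le> (2 powr \<alpha> * exp (- (norm (real_freq k))\<^sup>2 / 2)) * (?I / D)"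
      proof (cases "k = 0")
        case True
        then show ?thesis using I D by (simp add: remainder_coeff_def)
      next
        case False
        have "1 \<le> (norm (real_freq k))\<^sup>2"
          using norm_real_freq_ge_1[OF False] by (simp add: one_le_power)
        then have "\<bar>heat_remainder \<alpha> ((norm (real_freq k))\<^sup>2)\<bar> * norm (cell_coeff f k)
            \<le> (2 powr \<alpha> * exp (- (norm (real_freq k))\<^sup>2 / 2)) * (?I / D)"
          using abs_heat_remainder_le[OF \<alpha>] norm_cell_coeff_le[of f k]
          by (intro mult_mono) (auto simp: D_def)
        then show ?thesis using False by (simp add: remainder_coeff_def norm_mult)
      qed
      then show "ennreal (norm (remainder_coeff \<alpha> f k)) \<le> ennreal (2 powr \<alpha> / D * ?I) *
          ennreal (exp (- (1 / (8 * pi\<^sup>2)) * (norm ((0 :: real ^ 'n) + lattice_shift k))\<^sup>2))"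
        unfolding e using I D by (simp add: ennreal_mult[symmetric] ennreal_leI mult_ac)
    qed
    also have "\<dots> = ennreal (2 powr \<alpha> / D * ?I) *
        (\<integral>\<^sup>+k. ennreal (exp (- (1 / (8 * pi\<^sup>2)) * (norm ((0 :: real ^ 'n) + lattice_shift k))\<^sup>2)) \<partial>count_space UNIV)"
      by (rule nn_integral_cmult) simp
    also have "\<dots> \<le> ennreal (2 powr \<alpha> / D * ?I) * ennreal S"
      by (intro mult_left_mono S(2)) (auto simp: fund_cell_def)
    also have "\<dots> = ennreal (2 powr \<alpha> / D * S * ?I)"
      using I D S(1) by (simp add: ennreal_mult[symmetric] mult_ac)
    finally show ?thesis .
  qed
  have int: "integrable (count_space UNIV) (remainder_coeff \<alpha> f)" for f :: "real ^ 'n \<Rightarrow> complex"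
    using bound[of f] by (intro integrableI_bounded) (auto intro: le_less_trans)
  have "(LINT k|count_space UNIV. norm (remainder_coeff \<alpha> f k)) \<le> 2 powr \<alpha> / D * S * (LINT x|cell_measure. norm (f x))"
    for f :: "real ^ 'n \<Rightarrow> complex"
  proof -
    have "ennreal (LINT k|count_space UNIV. norm (remainder_coeff \<alpha> f k))
        = (\<integral>\<^sup>+k. ennreal (norm (remainder_coeff \<alpha> f k)) \<partial>count_space UNIV)"
      using int[of f] by (subst nn_integral_eq_integral) auto
    also note bound[of f]
    finally show ?thesis
      using D S(1) by (simp add: ennreal_le_iff)
  qed
  with int D S(1) that[of "2 powr \<alpha> / D * S"] show ?thesis by auto
qed

lemma norm_remainder_series_le:
  assumes \<alpha>: "0 < \<alpha>"
  obtains C where "0 < C"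
    "\<And>(f :: real ^ 'n \<Rightarrow> complex) x. norm (remainder_series \<alpha> f x) \<le> C * (LINT x|cell_measure. norm (f x))"
proof -
  obtain C where C: "0 < C"
    "\<And>f :: real ^ 'n \<Rightarrow> complex. integrable (count_space UNIV) (remainder_coeff \<alpha> f)"
    "\<And>f :: real ^ 'n \<Rightarrow> complex. (LINT k|count_space UNIV. norm (remainder_coeff \<alpha> f k)) \<le> C * (LINT x|cell_measure. norm (f x))"
    using remainder_coeff_summable[OF \<alpha>] by blast
  have "norm (remainder_series \<alpha> f x) \<le> C * (LINT x|cell_measure. norm (f x))" for f :: "real ^ 'n \<Rightarrow> complex" and x
    unfolding remainder_series_def
    using norm_trig_series_le[OF C(2)[of f], of x] C(3)[of f] by linarith
  with C(1) that show ?thesis by blast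
qed

text \<open>With l = |k|^2, the heat average has as multiplier the truncated Gamma integral at l,
  and the series adds the missing \<open>heat_remainder \<alpha> l\<close>; together they give
  l^(-\<alpha>). At k = 0 only the average acts, multiplying by the mass of the time measure, so the
  coefficient vanishes because that of f does.\<close>

lemma
  fixes f :: "real ^ 'n \<Rightarrow> complex"
  assumes \<alpha>: "0 < \<alpha>" and f: "f \<in> borel_measurable borel" "lattice_periodic f" "integrable cell_measure f"
  shows riesz_potential_measurable: "riesz_potential \<alpha> f \<in> borel_measurable borel"
    and riesz_potential_periodic: "lattice_periodic (riesz_potential \<alpha> f)"
    and riesz_potential_integrable: "integrable cell_measure (riesz_potential \<alpha> f)"
    and riesz_potential_coeff: "cell_coeff f 0 = 0 \<Longrightarrow> cell_coeff (riesz_potential \<alpha> f) k =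
      (if k = 0 then 0 else of_real (norm (real_freq k) powr - (2 * \<alpha>)) * cell_coeff f k)"
proof -
  interpret H: finite_measure "heat_measure \<alpha> :: (real \<times> (real ^ 'n)) measure"
    by (rule finite_measure_heat_measure[OF \<alpha>])
  interpret A: periodic_averaging "heat_measure \<alpha>" heat_path f
    using f by unfold_locales auto
  obtain C where c: "integrable (count_space UNIV) (remainder_coeff \<alpha> f)"
    using remainder_coeff_summable[OF \<alpha>] by blast
  note trig = trig_series_measurable[OF c] trig_series_periodic[OF c] norm_trig_series_le[OF c]
    trig_series_coeff[OF c]
  note trig = trig[folded remainder_series_def]
  have eq: "riesz_potential \<alpha> f = (\<lambda>x. A.average x + remainder_series \<alpha> f x)"
    by (simp add: fun_eq_iff riesz_potential_def A.average_def)
  have [measurable]: "remainder_series \<alpha> f \<in> borel_measurable borel"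
    using trig(1) by (simp add: remainder_series_def[abs_def])
  have [measurable]: "A.average \<in> borel_measurable borel" by (rule A.average_measurable)
  show "riesz_potential \<alpha> f \<in> borel_measurable borel"
    unfolding eq by measurable
  show "lattice_periodic (riesz_potential \<alpha> f)"
    using A.average_periodic trig(2) by (simp add: eq lattice_periodic_def remainder_series_def)
  have int: "integrable cell_measure (remainder_series \<alpha> f)"
    by (rule cell_measure.integrable_const_bound[OF AE_I2]) (use trig(3) in auto)
  show "integrable cell_measure (riesz_potential \<alpha> f)"
    unfolding eq using A.average_integrable int by (rule Bochner_Integration.integrable_add)
  assume f0: "cell_coeff f 0 = 0"
  let ?e = "\<lambda>x. cis (- (real_freq k \<bullet> x))"
  have mult: "integrable cell_measure (\<lambda>x. h x * ?e x)" if "integrable cell_measure h" for h :: "real ^ 'n \<Rightarrow> complex"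
    by (rule Bochner_Integration.integrable_bound[OF that])
       (use borel_measurable_integrable[OF that] in \<open>auto simp: norm_mult\<close>)
  have "(LINT x|cell_measure. riesz_potential \<alpha> f x * ?e x)
      = (LINT x|cell_measure. A.average x * ?e x) + (LINT x|cell_measure. remainder_series \<alpha> f x * ?e x)"
    unfolding eq distrib_right
    using mult[OF A.average_integrable] mult[OF int] by (rule Bochner_Integration.integral_add)
  also have "\<dots> = of_real (LINT t|time_measure \<alpha>. exp (- (t * (norm (real_freq k))\<^sup>2)))
        * (LINT x|cell_measure. f x * ?e x) + of_real ((2 * pi) ^ CARD('n)) * remainder_coeff \<alpha> f k"
    using trig(4)[of k] by (simp add: A.average_coeff integral_heat_measure_cis[OF \<alpha>])
  finally have "cell_coeff (riesz_potential \<alpha> f) k =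
      of_real (LINT t|time_measure \<alpha>. exp (- (t * (norm (real_freq k))\<^sup>2))) * cell_coeff f k + remainder_coeff \<alpha> f k"
    by (simp add: cell_coeff_def add_divide_distrib)
  then show "cell_coeff (riesz_potential \<alpha> f) k =
      (if k = 0 then 0 else of_real (norm (real_freq k) powr - (2 * \<alpha>)) * cell_coeff f k)"
  proof (cases "k = 0")
    case False
    have "(norm (real_freq k))\<^sup>2 powr - \<alpha> = norm (real_freq k) powr - (2 * \<alpha>)"
      using norm_real_freq_ge_1[OF False] by (simp add: powr_powr flip: powr_numeral)
    with False show ?thesis
      using \<open>cell_coeff (riesz_potential \<alpha> f) k = _\<close>
      by (simp add: remainder_coeff_def heat_remainder_def algebra_simps)
  qed (simp add: f0 remainder_coeff_def)
qed

text \<open>The embedding of L_p into L_1 on the cell, from the scalar splitting at level A; the two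
  terms contribute the volume and 1.\<close>

lemma nn_integral_norm_le_of_powr:
  fixes f :: "real ^ 'n \<Rightarrow> complex"
  assumes p: "1 \<le> p" and A: "0 < A" and [measurable]: "f \<in> borel_measurable borel"
    and fA: "(\<integral>\<^sup>+x. ennreal (norm (f x) powr p) \<partial>cell_measure) \<le> ennreal (A powr p)"
  shows "(\<integral>\<^sup>+x. ennreal (norm (f x)) \<partial>cell_measure) \<le> ennreal (((2 * pi) ^ CARD('n) + 1) * A)"
proof -
  let ?D = "(2 * pi) ^ CARD('n)"
  have D: "emeasure cell_measure (UNIV :: (real ^ 'n) set) = ennreal ?D"
    by (simp add: cell_measure.emeasure_eq_measure measure_cell_measure)
  have "(\<integral>\<^sup>+x. ennreal (norm (f x)) \<partial>cell_measure)
      \<le> (\<integral>\<^sup>+x. ennreal A + ennreal (A powr (1 - p)) * ennreal (norm (f x) powr p) \<partial>cell_measure)"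
    using le_add_powr_scaled[OF norm_ge_zero A p] A
    by (intro nn_integral_mono) (simp add: ennreal_mult[symmetric] ennreal_plus[symmetric] ennreal_leI del: ennreal_plus)
  also have "\<dots> = ennreal A * ennreal ?D + ennreal (A powr (1 - p)) * (\<integral>\<^sup>+x. ennreal (norm (f x) powr p) \<partial>cell_measure)"
    by (subst nn_integral_add) (auto simp: nn_integral_cmult D)
  also have "\<dots> \<le> ennreal A * ennreal ?D + ennreal (A powr (1 - p)) * ennreal (A powr p)"
    using fA by (intro add_left_mono mult_left_mono) auto
  also have "\<dots> = ennreal (A * ?D + A powr (1 - p) * A powr p)"
    using A by (simp add: ennreal_mult[symmetric] ennreal_plus[symmetric] del: ennreal_plus)
  also have "A powr (1 - p) * A powr p = A"
    using A by (simp add: powr_add[symmetric])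
  finally show ?thesis by (simp add: algebra_simps)
qed

lemma integral_norm_cell_measure_le:
  assumes "(\<integral>\<^sup>+x. ennreal (norm (f x)) \<partial>cell_measure) \<le> ennreal B" "0 \<le> B"
  shows "(LINT x|cell_measure. norm (f x)) \<le> B"
proof -
  have "(LINT x|cell_measure. norm (f x)) \<le> enn2real (\<integral>\<^sup>+x. ennreal (norm (f x)) \<partial>cell_measure)"
    using norm_integral_le_enn2real_nn_integral[of cell_measure "\<lambda>x. norm (f x)"] by simp
  also have "\<dots> \<le> B" using assms by (intro enn2real_leI) auto
  finally show ?thesis .
qed

lemma riesz_potential_sup_bound:
  assumes p: "1 \<le> p" and \<alpha>: "real CARD('n) / (2 * p) < \<alpha>"
  obtains C where "0 < C"
    "\<And>(f :: real ^ 'n \<Rightarrow> complex) A x. f \<in> borel_measurable borel \<Longrightarrow> lattice_periodic f \<Longrightarrow> 0 < A \<Longrightarrow>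
      (\<integral>\<^sup>+x. ennreal (norm (f x) powr p) \<partial>cell_measure) \<le> ennreal (A powr p) \<Longrightarrow>
      norm (riesz_potential \<alpha> f x) \<le> C * A"
proof -
  have \<alpha>0: "0 < \<alpha>" using \<alpha> p by (smt (verit) divide_nonneg_nonneg of_nat_0_le_iff)
  obtain C where C: "0 < C"
    "\<And>(f :: real ^ 'n \<Rightarrow> complex) A x. f \<in> borel_measurable borel \<Longrightarrow> lattice_periodic f \<Longrightarrow> 0 < A \<Longrightarrow>
      (\<integral>\<^sup>+x. ennreal (norm (f x) powr p) \<partial>cell_measure) \<le> ennreal (A powr p) \<Longrightarrow>
      norm (LINT w|heat_measure \<alpha>. f (x + heat_path w)) \<le> C * A"
    using heat_average_sup_bound[OF p \<alpha>] by blast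
  obtain R where R: "0 < R"
    "\<And>(f :: real ^ 'n \<Rightarrow> complex) x. norm (remainder_series \<alpha> f x) \<le> R * (LINT x|cell_measure. norm (f x))"
    using norm_remainder_series_le[OF \<alpha>0] by blast
  define D where "D = (2 * pi) ^ CARD('n) + 1"
  have D: "0 < D" by (simp add: D_def add_pos_nonneg)
  have "norm (riesz_potential \<alpha> f x) \<le> (C + R * D) * A"
    if f: "f \<in> borel_measurable borel" "lattice_periodic f" "0 < A"
      "(\<integral>\<^sup>+x. ennreal (norm (f x) powr p) \<partial>cell_measure) \<le> ennreal (A powr p)"
    for f :: "real ^ 'n \<Rightarrow> complex" and A x
  proof -
    have "(LINT x|cell_measure. norm (f x)) \<le> D * A"
      using nn_integral_norm_le_of_powr[OF p f(3,1,4)] D f(3)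
      by (intro integral_norm_cell_measure_le) (simp_all add: D_def)
    then have "R * (LINT x|cell_measure. norm (f x)) \<le> R * (D * A)"
      using R(1) by (intro mult_left_mono) auto
    then have "norm (LINT w|heat_measure \<alpha>. f (x + heat_path w)) + norm (remainder_series \<alpha> f x) \<le> C * A + R * (D * A)"
      using C(2)[OF f, of x] R(2)[of f x] by linarith
    then show ?thesis
      unfolding riesz_potential_def
      using norm_triangle_ineq[of "LINT w|heat_measure \<alpha>. f (x + heat_path w)" "remainder_series \<alpha> f x"]
      by (simp add: algebra_simps)
  qed
  moreover have "0 < C + R * D" using C(1) R(1) D by (simp add: add_pos_pos)
  ultimately show ?thesis using that by blast
qed

text \<open>A triangle inequality for q-th powers up to a constant, via the larger summand; it
  stands in for Minkowski's inequality.\<close>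

lemma add_powr_le:
  fixes a b q :: real
  assumes "0 \<le> a" "0 \<le> b" "0 \<le> q"
  shows "(a + b) powr q \<le> 2 powr q * (a powr q + b powr q)"
proof -
  have "(a + b) powr q \<le> (2 * max a b) powr q"
    using assms by (intro powr_mono2) auto
  also have "\<dots> = 2 powr q * max a b powr q"
    using assms by (simp add: powr_mult)
  also have "\<dots> \<le> 2 powr q * (a powr q + b powr q)"
    by (intro mult_left_mono) (auto simp: max_def)
  finally show ?thesis .
qed

lemma riesz_potential_Lq_bound:
  assumes q: "1 < q" and \<alpha>: "real CARD('n) / 2 * (1 - 1 / q) < \<alpha>"
  obtains C where "0 < C"
    "\<And>(f :: real ^ 'n \<Rightarrow> complex) A. f \<in> borel_measurable borel \<Longrightarrow> lattice_periodic f \<Longrightarrow> 0 < A \<Longrightarrow>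
      (\<integral>\<^sup>+x. ennreal (norm (f x)) \<partial>cell_measure) \<le> ennreal A \<Longrightarrow>
      (\<integral>\<^sup>+x. ennreal (norm (riesz_potential \<alpha> f x) powr q) \<partial>cell_measure) \<le> ennreal ((C * A) powr q)"
proof -
  have "0 \<le> real CARD('n) / 2 * (1 - 1 / q)" using q by simp
  then have \<alpha>0: "0 < \<alpha>" using \<alpha> by linarith
  obtain C where C: "0 < C"
    "\<And>(f :: real ^ 'n \<Rightarrow> complex) A. f \<in> borel_measurable borel \<Longrightarrow> lattice_periodic f \<Longrightarrow> 0 < A \<Longrightarrow>
      (\<integral>\<^sup>+x. ennreal (norm (f x)) \<partial>cell_measure) \<le> ennreal A \<Longrightarrow>
      (\<integral>\<^sup>+x. ennreal (norm (LINT w|heat_measure \<alpha>. f (x + heat_path w)) powr q) \<partial>cell_measure)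
        \<le> ennreal ((C * A) powr q)"
    using heat_average_Lq_bound[OF q \<alpha>] by blast
  obtain R where R: "0 < R"
    "\<And>(f :: real ^ 'n \<Rightarrow> complex) x. norm (remainder_series \<alpha> f x) \<le> R * (LINT x|cell_measure. norm (f x))"
    using norm_remainder_series_le[OF \<alpha>0] by blast
  interpret H: finite_measure "heat_measure \<alpha> :: (real \<times> (real ^ 'n)) measure"
    by (rule finite_measure_heat_measure[OF \<alpha>0])
  let ?D = "(2 * pi) ^ CARD('n)"
  have D: "emeasure cell_measure (UNIV :: (real ^ 'n) set) = ennreal ?D"
    by (simp add: cell_measure.emeasure_eq_measure measure_cell_measure)
  \<comment> \<open>Chosen so that \<open>K powr q\<close> is the total constant: C from the heat
    average, and R times the volume of the cell from the uniformly bounded series.\<close>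
  define K where "K = (2 powr q * (C powr q + R powr q * ?D)) powr (1 / q)"
  have pos: "0 < C powr q + R powr q * ?D"
    using C(1) R(1) by (intro add_pos_pos mult_pos_pos) auto
  then have K: "0 < K" by (simp add: K_def)
  have Kq: "K powr q = 2 powr q * (C powr q + R powr q * ?D)"
    using pos q by (simp add: K_def powr_powr)
  have "(\<integral>\<^sup>+x. ennreal (norm (riesz_potential \<alpha> f x) powr q) \<partial>cell_measure) \<le> ennreal ((K * A) powr q)"
    if f: "f \<in> borel_measurable borel" "lattice_periodic f" "0 < A"
      "(\<integral>\<^sup>+x. ennreal (norm (f x)) \<partial>cell_measure) \<le> ennreal A"
    for f :: "real ^ 'n \<Rightarrow> complex" and A
  proof -
    have [measurable]: "f \<in> borel_measurable borel" by fact
    let ?a = "\<lambda>x. LINT w|heat_measure \<alpha>. f (x + heat_path w)"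
    have "(LINT x|cell_measure. norm (f x)) \<le> A"
      using f(3,4) by (intro integral_norm_cell_measure_le) auto
    then have "R * (LINT x|cell_measure. norm (f x)) \<le> R * A"
      using R(1) by (intro mult_left_mono) auto
    then have r: "norm (remainder_series \<alpha> f x) \<le> R * A" for x
      using R(2)[of f x] by linarith
    have "(\<integral>\<^sup>+x. ennreal (norm (riesz_potential \<alpha> f x) powr q) \<partial>cell_measure)
        \<le> (\<integral>\<^sup>+x. ennreal (2 powr q) * (ennreal (norm (?a x) powr q) + ennreal ((R * A) powr q)) \<partial>cell_measure)"
    proof (intro nn_integral_mono)
      fix x
      have "norm (riesz_potential \<alpha> f x) \<le> norm (?a x) + R * A"
        unfolding riesz_potential_def
        using norm_triangle_ineq[of "?a x" "remainder_series \<alpha> f x"] r[of x] by linarith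
      then have "norm (riesz_potential \<alpha> f x) powr q \<le> (norm (?a x) + R * A) powr q"
        using q by (intro powr_mono2) auto
      also have "\<dots> \<le> 2 powr q * (norm (?a x) powr q + (R * A) powr q)"
        using q R(1) f(3) by (intro add_powr_le) auto
      finally show "ennreal (norm (riesz_potential \<alpha> f x) powr q)
          \<le> ennreal (2 powr q) * (ennreal (norm (?a x) powr q) + ennreal ((R * A) powr q))"
        by (simp add: ennreal_mult[symmetric] ennreal_plus[symmetric] ennreal_leI del: ennreal_plus)
    qed
    also have "\<dots> = ennreal (2 powr q) *
        ((\<integral>\<^sup>+x. ennreal (norm (?a x) powr q) \<partial>cell_measure) + ennreal ((R * A) powr q) * ennreal ?D)"
      by (subst nn_integral_cmult, measurable, subst nn_integral_add) (auto simp: D)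
    also have "\<dots> \<le> ennreal (2 powr q) * (ennreal ((C * A) powr q) + ennreal ((R * A) powr q) * ennreal ?D)"
      using C(2)[OF f] by (intro mult_left_mono add_right_mono) auto
    also have "\<dots> = ennreal (2 powr q * ((C * A) powr q + (R * A) powr q * ?D))"
      by (simp add: ennreal_mult[symmetric] ennreal_plus[symmetric] del: ennreal_plus)
    also have "2 powr q * ((C * A) powr q + (R * A) powr q * ?D) = (K * A) powr q"
      using C(1) R(1) K f(3) by (simp add: powr_mult Kq algebra_simps)
    finally show ?thesis .
  qed
  with K that show ?thesis by blast
qed

section \<open>From Lebesgue measurable functions on the closed cube to periodic Borel
  functions\<close>

lemma AE_fund_cell_iff_cbox: "AE x in lborel. x \<in> (fund_cell :: (real ^ 'n) set) \<longleftrightarrow> x \<in> cbox 0 (\<chi> i. 2 * pi)"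
proof -
  have null: "cbox 0 (\<chi> i. 2 * pi) - (box 0 (\<chi> i. 2 * pi) :: (real ^ 'n) set) \<in> null_sets lborel"
    unfolding null_sets_def
    by (auto intro!: trans[OF emeasure_Diff] simp: emeasure_lborel_cbox_eq emeasure_lborel_box_eq intro: subsetD[OF box_subset_cbox])
  show ?thesis
    by (rule eventually_mono[OF AE_not_in[OF null]])
       (use box_subset_fund_cell[where 'n = 'n] fund_cell_subset_cbox[where 'n = 'n] in auto)
qed

lemma measurable_ident_torus_measure [measurable]: "(\<lambda>x. x) \<in> torus_measure \<rightarrow>\<^sub>M borel"
  unfolding torus_measure_def
  by (intro measurable_restrict_space1 measurable_completion) simp

text \<open>The identity map into the Borel space forgets the completion; what then distinguishes
  the closed cube from the half-open cell is a null part of the boundary.\<close>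

lemma distr_torus_measure: "distr torus_measure borel (\<lambda>x. x) = (cell_measure :: (real ^ 'n) measure)"
proof (rule measure_eqI)
  let ?Q = "cbox 0 (\<chi> i. 2 * pi) :: (real ^ 'n) set"
  fix A :: "(real ^ 'n) set" assume "A \<in> sets (distr torus_measure borel (\<lambda>x. x))"
  then have [measurable]: "A \<in> sets borel" by simp
  have "emeasure (distr torus_measure borel (\<lambda>x. x)) A = emeasure torus_measure (A \<inter> ?Q)"
    by (subst emeasure_distr[OF measurable_ident_torus_measure]) (auto simp: torus_measure_def space_restrict_space)
  also have "\<dots> = emeasure lborel (A \<inter> ?Q)"
    unfolding torus_measure_def by (subst emeasure_restrict_space) auto
  also have "\<dots> = emeasure lborel (A \<inter> fund_cell)"
    using AE_fund_cell_iff_cbox by (intro emeasure_eq_AE) auto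
  also have "\<dots> = emeasure cell_measure A"
  proof -
    have "emeasure lborel (A \<inter> fund_cell) = (\<integral>\<^sup>+x. indicator (A \<inter> fund_cell) x \<partial>lborel)" by simp
    also have "\<dots> = (\<integral>\<^sup>+x. indicator A x \<partial>cell_measure)"
      by (simp only: indicator_inter_arith) (rule nn_integral_cell_measure[symmetric], simp)
    finally show ?thesis by simp
  qed
  finally show "emeasure (distr torus_measure borel (\<lambda>x. x)) A = emeasure cell_measure A" .
qed simp

lemma
  fixes h :: "real ^ 'n \<Rightarrow> 'b::{banach, second_countable_topology}"
  assumes "h \<in> borel_measurable borel"
  shows integral_torus_measure: "(LINT x|torus_measure. h x) = (LINT x|cell_measure. h x)"
    and integrable_torus_measure: "integrable torus_measure h \<longleftrightarrow> integrable cell_measure h"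
  using assms unfolding distr_torus_measure[symmetric]
  by (simp_all add: integral_distr integrable_distr_eq)

lemma fourier_coeff_eq_cell_coeff:
  assumes [measurable]: "f \<in> borel_measurable borel"
  shows "fourier_coeff f k = cell_coeff f k"
  unfolding fourier_coeff_def cell_coeff_def by (subst integral_torus_measure) auto

text \<open>Extend f by zero outside the cube, take Borel versions of real and imaginary parts, and
  compose with \<open>cell_rep\<close>. The composition forces exact periodicity and changes nothing
  on the cell, which is almost all of the cube.\<close>

lemma lattice_periodic_borel_representative:
  fixes f :: "real ^ 'n \<Rightarrow> complex"
  assumes "f \<in> borel_measurable torus_measure"
  obtains h where "h \<in> borel_measurable borel" "lattice_periodic h" "AE x in torus_measure. f x = h x"
proof -
  let ?Q = "cbox 0 (\<chi> i. 2 * pi) :: (real ^ 'n) set"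
  have [measurable]: "(\<lambda>x. if x \<in> ?Q then f x else 0) \<in> borel_measurable lebesgue"
    using assms unfolding torus_measure_def by (subst (asm) borel_measurable_if_lebesgue_on[symmetric]) auto
  have re: "(\<lambda>x. Re (if x \<in> ?Q then f x else 0)) \<in> borel_measurable lebesgue"
    and im: "(\<lambda>x. Im (if x \<in> ?Q then f x else 0)) \<in> borel_measurable lebesgue"
    by measurable
  obtain u where [measurable]: "u \<in> borel_measurable borel"
    and u: "AE x in lborel. Re (if x \<in> ?Q then f x else 0) = u x"
    using completion_ex_borel_measurable_real[OF re] by auto
  obtain v where [measurable]: "v \<in> borel_measurable borel"
    and v: "AE x in lborel. Im (if x \<in> ?Q then f x else 0) = v x"
    using completion_ex_borel_measurable_real[OF im] by auto
  define h where "h x = Complex (u (cell_rep x)) (v (cell_rep x))" for x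
  have "AE x in lborel. x \<in> ?Q \<longrightarrow> f x = h x"
    using u v AE_fund_cell_iff_cbox
  proof eventually_elim
    case (elim x)
    then show ?case by (auto simp: h_def cell_rep_id complex_eq_iff)
  qed
  then have "AE x in torus_measure. f x = h x"
    unfolding torus_measure_def by (subst AE_restrict_space_iff) (auto intro: AE_completion)
  moreover have "lattice_periodic h"
    by (simp add: lattice_periodic_def h_def cell_rep_add_lattice_shift)
  moreover have "h \<in> borel_measurable borel"
    unfolding h_def Complex_eq by measurable
  ultimately show ?thesis using that by blast
qed

lemma torus_LpI:
  fixes g :: "real ^ 'n \<Rightarrow> complex"
  assumes [measurable]: "g \<in> borel_measurable borel" and g: "lattice_periodic g"
    and q: "1 \<le> q" and K: "0 \<le> K"
    and gK: "(\<integral>\<^sup>+x. ennreal (norm (g x) powr q) \<partial>cell_measure) \<le> ennreal (K powr q)"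
  shows "g \<in> torus_Lp (ennreal q)" "torus_norm (ennreal q) g \<le> K"
proof -
  have [measurable]: "g \<in> borel_measurable torus_measure"
    using measurable_compose[OF measurable_ident_torus_measure assms(1)] .
  have [measurable]: "(\<lambda>x. norm (g x) powr q) \<in> borel_measurable borel"
    by measurable
  have int: "integrable cell_measure (\<lambda>x. norm (g x) powr q)"
    using gK by (intro integrableI_bounded) (auto intro: le_less_trans simp: measurable_cong_sets[OF sets_cell_measure refl])
  then show "g \<in> torus_Lp (ennreal q)"
    using g q by (simp add: torus_Lp_def lattice_periodic_imp_torus_periodic integrable_torus_measure)
  have "ennreal (LINT x|cell_measure. norm (g x) powr q) \<le> ennreal (K powr q)"
    using gK int by (subst nn_integral_eq_integral[symmetric]) auto
  then have "(LINT x|cell_measure. norm (g x) powr q) \<le> K powr q" by simp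
  then have "(LINT x|cell_measure. norm (g x) powr q) powr (1 / q) \<le> (K powr q) powr (1 / q)"
    using q by (intro powr_mono2) auto
  also have "\<dots> = K" using q K by (simp add: powr_powr)
  finally show "torus_norm (ennreal q) g \<le> K"
    using q by (simp add: torus_norm_def integral_torus_measure)
qed

lemma torus_L_infinityI:
  fixes g :: "real ^ 'n \<Rightarrow> complex"
  assumes "g \<in> borel_measurable borel" and g: "lattice_periodic g"
    and gK: "\<And>x. norm (g x) \<le> K" and K: "0 \<le> K"
  shows "g \<in> torus_Lp \<infinity>" "torus_norm \<infinity> g \<le> K"
proof -
  have [measurable]: "g \<in> borel_measurable torus_measure"
    using measurable_compose[OF measurable_ident_torus_measure assms(1)] .
  have le: "esssup torus_measure (\<lambda>x. ennreal (norm (g x))) \<le> ennreal K"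
    using gK by (intro esssup_I) (auto intro: ennreal_leI)
  then show "g \<in> torus_Lp \<infinity>"
    using g by (auto simp: torus_Lp_def lattice_periodic_imp_torus_periodic intro: le_less_trans)
  show "torus_norm \<infinity> g \<le> K"
    using le K by (auto simp: torus_norm_def enn2real_leI)
qed

lemma enn2real_one_divide_ennreal:
  assumes "0 < p"
  shows "enn2real (1 / ennreal p) = 1 / p"
proof -
  have "1 / ennreal p = ennreal (1 / p)"
    using divide_ennreal[of 1 p] assms by simp
  then show ?thesis using assms by simp
qed

text \<open>The norm and the Fourier coefficients see only the almost-everywhere class of f, so they
  pass to the representative unchanged.\<close>

lemma torus_Lp_borel_representative:
  fixes f :: "real ^ 'n \<Rightarrow> complex"
  assumes f: "f \<in> torus_Lp (ennreal p)" and p: "1 \<le> p"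
  obtains h where "h \<in> borel_measurable borel" "lattice_periodic h" "integrable cell_measure h"
    "(\<integral>\<^sup>+x. ennreal (norm (h x) powr p) \<partial>cell_measure) = ennreal (torus_norm (ennreal p) f powr p)"
    "\<And>k. fourier_coeff f k = cell_coeff h k"
proof -
  have f_meas [measurable]: "f \<in> borel_measurable torus_measure"
    and f_int: "integrable torus_measure (\<lambda>x. norm (f x) powr p)"
    using f p by (auto simp: torus_Lp_def)
  obtain h where h: "h \<in> borel_measurable borel" "lattice_periodic h" "AE x in torus_measure. f x = h x"
    using lattice_periodic_borel_representative[OF f_meas] by blast
  have [measurable]: "h \<in> borel_measurable borel" by fact
  have [measurable]: "h \<in> borel_measurable torus_measure"
    using measurable_compose[OF measurable_ident_torus_measure h(1)] .
  have [measurable]: "(\<lambda>x. norm (h x) powr p) \<in> borel_measurable borel"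
    by measurable
  have "integrable torus_measure (\<lambda>x. norm (h x) powr p)"
    using h(3) by (intro integrable_cong_AE_imp[OF f_int]) auto
  then have hp_int: "integrable cell_measure (\<lambda>x. norm (h x) powr p)"
    by (simp add: integrable_torus_measure)
  have eq: "(LINT x|torus_measure. norm (f x) powr p) = (LINT x|cell_measure. norm (h x) powr p)"
    using h(3) by (subst integral_torus_measure[symmetric]) (auto intro!: integral_cong_AE)
  have "torus_norm (ennreal p) f powr p = (LINT x|cell_measure. norm (h x) powr p)"
    using p by (simp add: torus_norm_def eq powr_powr)
  then have hp: "(\<integral>\<^sup>+x. ennreal (norm (h x) powr p) \<partial>cell_measure) = ennreal (torus_norm (ennreal p) f powr p)"
    using hp_int by (subst nn_integral_eq_integral) auto
  have h_int: "integrable cell_measure h"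
  proof (rule Bochner_Integration.integrable_bound)
    show "integrable cell_measure (\<lambda>x. 1 + norm (h x) powr p)"
      using hp_int by simp
    show "AE x in cell_measure. norm (h x) \<le> norm (1 + norm (h x) powr p)"
      \<comment> \<open>At level 1 the splitting gives |h| \<le> 1 + |h|^p, integrable on a finite
        measure.\<close>
      using le_add_powr_scaled[of "norm (h x)" 1 p for x] p by simp
  qed (simp add: h(1) measurable_cong_sets[OF sets_cell_measure refl])
  have "fourier_coeff f k = fourier_coeff h k" for k
    unfolding fourier_coeff_def using h(3)
    by (intro arg_cong2[where f = "(/)"] refl integral_cong_AE) auto
  then have "fourier_coeff f k = cell_coeff h k" for k
    by (simp add: fourier_coeff_eq_cell_coeff)
  with h h_int hp that show ?thesis by blast
qed

section \<open>Assembly on the torus\<close>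

text \<open>\<open>is_frac_integral\<close> depends on f only through its Fourier coefficients, so
  the potential of the representative \<open>h\<close> serves for f; the vanishing integral is the
  coefficient at 0.\<close>

lemma riesz_potential_is_frac_integral:
  fixes f h :: "real ^ 'n \<Rightarrow> complex"
  assumes \<gamma>: "0 < \<gamma>" and h: "h \<in> borel_measurable borel" "lattice_periodic h" "integrable cell_measure h"
    and fh: "\<And>k. fourier_coeff f k = cell_coeff h k" and f0: "(LINT x|torus_measure. f x) = 0"
  shows "is_frac_integral \<gamma> f (riesz_potential (\<gamma> / 2) h)"
proof -
  let ?g = "riesz_potential (\<gamma> / 2) h"
  have \<alpha>: "0 < \<gamma> / 2" using \<gamma> by simp
  note g = riesz_potential_measurable[OF \<alpha> h] riesz_potential_periodic[OF \<alpha> h] riesz_potential_integrable[OF \<alpha> h]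
  have "(\<integral>\<^sup>+x. ennreal (norm (?g x) powr 1) \<partial>cell_measure) = ennreal ((LINT x|cell_measure. norm (?g x)) powr 1)"
    using g(3) by (simp add: nn_integral_eq_integral)
  then have "?g \<in> torus_Lp (ennreal 1)"
    by (intro torus_LpI(1)[OF g(1,2), of 1 "LINT x|cell_measure. norm (?g x)"]) auto
  moreover have "fourier_coeff f 0 = 0"
    using f0 by (simp add: fourier_coeff_def real_freq_def zero_vec_def[symmetric])
  then have "cell_coeff h 0 = 0" using fh[of 0] by simp
  then have "fourier_coeff ?g k = (if k = 0 then 0 else of_real (norm (real_freq k) powr - \<gamma>) * fourier_coeff f k)" for k
    using riesz_potential_coeff[OF \<alpha> h, of k] by (simp add: fourier_coeff_eq_cell_coeff[OF g(1)] fh)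
  ultimately show ?thesis
    unfolding is_frac_integral_def by simp
qed

text \<open>With \<alpha> = \<gamma>/2 the condition on \<gamma> reads \<alpha> > d/(2p) for q =
  \<infinity> and \<alpha> > (d/2)(1 - 1/q) for p = 1, the hypotheses of the two bounds. The corner
  p = 1, q = \<infinity> is treated by the supremum bound.\<close>

lemma torus_norm_riesz_potential_le:
  fixes q :: ennreal
  assumes p: "1 \<le> p" and pq: "ennreal p < q" and endpoint: "p = 1 \<or> q = \<infinity>"
    and \<gamma>: "real CARD('n) * (1 / p - enn2real (1 / q)) < \<gamma>"
  obtains C where "0 < C"
    "\<And>(h :: real ^ 'n \<Rightarrow> complex) A. h \<in> borel_measurable borel \<Longrightarrow> lattice_periodic h \<Longrightarrow>
      integrable cell_measure h \<Longrightarrow> 0 < A \<Longrightarrow>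
      (\<integral>\<^sup>+x. ennreal (norm (h x) powr p) \<partial>cell_measure) \<le> ennreal (A powr p) \<Longrightarrow>
      riesz_potential (\<gamma> / 2) h \<in> torus_Lp q \<and> torus_norm q (riesz_potential (\<gamma> / 2) h) \<le> C * A"
proof (cases "q = \<infinity>")
  case True
  have \<alpha>: "real CARD('n) / (2 * p) < \<gamma> / 2"
    using \<gamma> True by simp
  then have \<alpha>0: "0 < \<gamma> / 2" using p by (smt (verit) divide_nonneg_nonneg of_nat_0_le_iff)
  obtain C where C: "0 < C"
    "\<And>(f :: real ^ 'n \<Rightarrow> complex) A x. f \<in> borel_measurable borel \<Longrightarrow> lattice_periodic f \<Longrightarrow> 0 < A \<Longrightarrow>
      (\<integral>\<^sup>+x. ennreal (norm (f x) powr p) \<partial>cell_measure) \<le> ennreal (A powr p) \<Longrightarrow>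
      norm (riesz_potential (\<gamma> / 2) f x) \<le> C * A"
    using riesz_potential_sup_bound[OF p \<alpha>] by blast
  show ?thesis
  proof (rule that[OF C(1)])
    fix h :: "real ^ 'n \<Rightarrow> complex" and A :: real
    assume h: "h \<in> borel_measurable borel" "lattice_periodic h" "integrable cell_measure h" "0 < A"
      "(\<integral>\<^sup>+x. ennreal (norm (h x) powr p) \<partial>cell_measure) \<le> ennreal (A powr p)"
    show "riesz_potential (\<gamma> / 2) h \<in> torus_Lp q \<and> torus_norm q (riesz_potential (\<gamma> / 2) h) \<le> C * A"
      unfolding True
      using torus_L_infinityI[OF riesz_potential_measurable[OF \<alpha>0 h(1-3)] riesz_potential_periodic[OF \<alpha>0 h(1-3)] C(2)[OF h(1,2,4,5)]]
        C(1) h(4) by simp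
  qed
next
  case False
  with endpoint have p1: "p = 1" by simp
  obtain r where r: "q = ennreal r" "1 < r"
    using False pq p1 by (cases q) auto
  have \<alpha>: "real CARD('n) / 2 * (1 - 1 / r) < \<gamma> / 2"
    using \<gamma> r p1 by (simp add: enn2real_one_divide_ennreal)
  moreover have "0 \<le> real CARD('n) / 2 * (1 - 1 / r)" using r by simp
  ultimately have \<alpha>0: "0 < \<gamma> / 2" by linarith
  obtain C where C: "0 < C"
    "\<And>(f :: real ^ 'n \<Rightarrow> complex) A. f \<in> borel_measurable borel \<Longrightarrow> lattice_periodic f \<Longrightarrow> 0 < A \<Longrightarrow>
      (\<integral>\<^sup>+x. ennreal (norm (f x)) \<partial>cell_measure) \<le> ennreal A \<Longrightarrow>
      (\<integral>\<^sup>+x. ennreal (norm (riesz_potential (\<gamma> / 2) f x) powr r) \<partial>cell_measure) \<le> ennreal ((C * A) powr r)"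
    using riesz_potential_Lq_bound[OF r(2) \<alpha>] by blast
  show ?thesis
  proof (rule that[OF C(1)])
    fix h :: "real ^ 'n \<Rightarrow> complex" and A :: real
    assume h: "h \<in> borel_measurable borel" "lattice_periodic h" "integrable cell_measure h" "0 < A"
      "(\<integral>\<^sup>+x. ennreal (norm (h x) powr p) \<partial>cell_measure) \<le> ennreal (A powr p)"
    have "(\<integral>\<^sup>+x. ennreal (norm (h x)) \<partial>cell_measure) \<le> ennreal A"
      using h(4,5) p1 by simp
    then show "riesz_potential (\<gamma> / 2) h \<in> torus_Lp q \<and> torus_norm q (riesz_potential (\<gamma> / 2) h) \<le> C * A"
      unfolding r(1)
      using torus_LpI[OF riesz_potential_measurable[OF \<alpha>0 h(1-3)] riesz_potential_periodic[OF \<alpha>0 h(1-3)] _ _ C(2)[OF h(1,2,4)]]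
        C(1) h(4) r(2) by simp
  qed
qed

theorem corollary5p3:
  fixes p q :: ennreal and \<gamma> :: real
  assumes "1 \<le> p" and "p < q" and "q \<le> \<infinity>"
    and "p = 1 \<or> q = \<infinity>"
    and "\<gamma> > real CARD('n) * (enn2real (1 / p) - enn2real (1 / q))"
  shows "\<exists>C>0. \<forall>f :: real ^ 'n \<Rightarrow> complex.
    f \<in> torus_Lp p \<and> (LINT x|torus_measure. f x) = 0 \<longrightarrow>
    (\<exists>g. is_frac_integral \<gamma> f g \<and> g \<in> torus_Lp q \<and> torus_norm q g \<le> C * torus_norm p f)"
proof -
  obtain r where r: "p = ennreal r" "1 \<le> r"
    using assms(1,2) by (cases p) auto
  have inv_p: "enn2real (1 / p) = 1 / r"
    using r by (simp add: enn2real_one_divide_ennreal)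
  \<comment> \<open>Makes the lower bound for \<gamma> nonnegative, hence \<gamma> > 0, which the
    Gamma integral requires.\<close>
  have "enn2real (1 / q) \<le> enn2real (1 / p)"
  proof (cases q)
    case (real s)
    then have "r < s" using assms(2) r by (simp add: ennreal_less_iff)
    then show ?thesis
      using real r by (simp add: enn2real_one_divide_ennreal frac_le)
  qed (use r in \<open>simp add: inv_p\<close>)
  then have \<gamma>: "0 < \<gamma>"
    using assms(5) by (smt (verit) mult_nonneg_nonneg of_nat_0_le_iff)
  have "ennreal r < q" "r = 1 \<or> q = \<infinity>" "real CARD('n) * (1 / r - enn2real (1 / q)) < \<gamma>"
    using assms(2,4,5) r inv_p by auto
  note C_exists = torus_norm_riesz_potential_le[OF r(2) this]
  obtain C where C: "0 < C"
    "\<And>(h :: real ^ 'n \<Rightarrow> complex) A. h \<in> borel_measurable borel \<Longrightarrow> lattice_periodic h \<Longrightarrow>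
      integrable cell_measure h \<Longrightarrow> 0 < A \<Longrightarrow>
      (\<integral>\<^sup>+x. ennreal (norm (h x) powr r) \<partial>cell_measure) \<le> ennreal (A powr r) \<Longrightarrow>
      riesz_potential (\<gamma> / 2) h \<in> torus_Lp q \<and> torus_norm q (riesz_potential (\<gamma> / 2) h) \<le> C * A"
    using C_exists by blast
  show ?thesis
  proof (intro exI[of _ C] conjI allI impI C(1))
    fix f :: "real ^ 'n \<Rightarrow> complex"
    assume f: "f \<in> torus_Lp p \<and> (LINT x|torus_measure. f x) = 0"
    then obtain h where h: "h \<in> borel_measurable borel" "lattice_periodic h" "integrable cell_measure h"
      "(\<integral>\<^sup>+x. ennreal (norm (h x) powr r) \<partial>cell_measure) = ennreal (torus_norm p f powr r)"
      "\<And>k. fourier_coeff f k = cell_coeff h k"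
      using torus_Lp_borel_representative[of f r] r by auto
    let ?g = "riesz_potential (\<gamma> / 2) h"
    have norm_nonneg: "0 \<le> torus_norm p f"
      by (simp add: torus_norm_def)
    \<comment> \<open>The norm of f may be 0 while A has to be positive, hence the extra
      \<open>e\<close>.\<close>
    have bound: "?g \<in> torus_Lp q \<and> torus_norm q ?g \<le> C * (torus_norm p f + e)" if "0 < e" for e
    proof (rule C(2)[OF h(1-3)])
      have "torus_norm p f powr r \<le> (torus_norm p f + e) powr r"
        using norm_nonneg that r by (intro powr_mono2) auto
      then show "(\<integral>\<^sup>+x. ennreal (norm (h x) powr r) \<partial>cell_measure) \<le> ennreal ((torus_norm p f + e) powr r)"
        unfolding h(4) by (rule ennreal_leI)
    qed (use norm_nonneg that in simp)
    have "torus_norm q ?g \<le> C * torus_norm p f + e" if "0 < e" for e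
      \<comment> \<open>The function \<open>?g\<close> does not depend on \<open>e\<close>, so
        \<open>e\<close> may tend to 0 in the bound.\<close>
      using bound[of "e / C"] that C(1) by (simp add: distrib_left)
    then have "torus_norm q ?g \<le> C * torus_norm p f"
      by (rule field_le_epsilon)
    moreover have "is_frac_integral \<gamma> f ?g"
      using \<gamma> h f by (intro riesz_potential_is_frac_integral) auto
    ultimately show "\<exists>g. is_frac_integral \<gamma> f g \<and> g \<in> torus_Lp q \<and> torus_norm q g \<le> C * torus_norm p f"
      using bound[of 1] by auto
  qed
qed

end
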